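(* Let $n\in\mathbb{N}$ and $\alpha>-1$. The family $(b^{(\alpha)}_{p,q})_{p\in\mathbb{N}_0,\,0\le q<n}$ is an orthonormal basis of $\mathcal{A}_n^2(\mathbb{D},\mu_\alpha)$.
   Context: $\mathbb{N}=\{1,2,\dots\}$, $\mathbb{N}_0=\{0,1,2,\dots\}$, $\mathbb{D}=\{z\in\mathbb{C}:|z|<1\}$. The measure $\mu_\alpha$ on $\mathbb{D}$ is $\mathrm{d}\mu_\alpha(z)=\frac{\alpha+1}{\pi}(1-|z|^2)^\alpha\,\mathrm{d}\mu(z)$, where $\mu$ is Lebesgue plane measure. A function $f$ on an open set of $\mathbb{C}$ is $n$-analytic if it is smooth and $(\partial/\partial\overline{z})^n f=0$. $\mathcal{A}_n^2(\mathbb{D},\mu_\alpha)$ is the space of $n$-analytic functions on $\mathbb{D}$ that are square-integrable with respect to $\mu_\alpha$, with the inner product of $L^2(\mathbb{D},\mu_\alpha)$. For $p,q\in\mathbb{N}_0$, the (normalized) disk polynomial is $$b^{(\alpha)}_{p,q}(z)=(-1)^{p+q}\,\widetilde{c}^{(\alpha)}_{p,q}\,(1-z\overline{z})^{-\alpha}\,\frac{\partial^q}{\partial z^q}\frac{\partial^p}{\partial\overline{z}^p}\Bigl((1-z\overline{z})^{p+q+\alpha}\Bigr),\qquad \widetilde{c}^{(\alpha)}_{p,q}=\sqrt{\frac{(\alpha+p+q+1)\Gamma(\alpha+p+1)\Gamma(\alpha+q+1)}{(\alpha+1)\,p!\,q!\,\Gamma(\alpha+p+q+1)^2}}.$$ 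*)

theory Defs
  imports "HOL-Analysis.Analysis"
begin

text \<open>Real smoothness: all iterated directional derivatives exist and are continuous.
  Meant for open sets \<open>S\<close>, since derivatives are taken at (not within) the points.\<close>

primrec times_differentiable_on ::
  "nat \<Rightarrow> ('a::real_normed_vector \<Rightarrow> 'b::real_normed_vector) \<Rightarrow> 'a set \<Rightarrow> bool" where
  "times_differentiable_on 0 f S \<longleftrightarrow> continuous_on S f"
| "times_differentiable_on (Suc k) f S \<longleftrightarrow>
     (\<forall>x\<in>S. f differentiable (at x)) \<and>
     (\<forall>v. times_differentiable_on k (\<lambda>x. frechet_derivative f (at x) v) S)"

definition smooth_on :: "('a::real_normed_vector \<Rightarrow> 'b::real_normed_vector) \<Rightarrow> 'a set \<Rightarrow> bool" where
  "smooth_on f S \<longleftrightarrow> (\<forall>k. times_differentiable_on k f S)"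

text \<open>Wirtinger derivatives; \<open>frechet_derivative f (at z)\<close> is the real-linear derivative, so its
  values at \<open>1\<close> and \<open>\<i>\<close> are the partial derivatives in the real and imaginary part of \<open>z\<close>.\<close>

definition wirtinger_z :: "(complex \<Rightarrow> complex) \<Rightarrow> complex \<Rightarrow> complex" where
  "wirtinger_z f z =
     (frechet_derivative f (at z) 1 - \<i> * frechet_derivative f (at z) \<i>) / 2"

definition wirtinger_zbar :: "(complex \<Rightarrow> complex) \<Rightarrow> complex \<Rightarrow> complex" where
  "wirtinger_zbar f z =
     (frechet_derivative f (at z) 1 + \<i> * frechet_derivative f (at z) \<i>) / 2"

definition n_analytic_on :: "nat \<Rightarrow> (complex \<Rightarrow> complex) \<Rightarrow> complex set \<Rightarrow> bool" where
  "n_analytic_on n f S \<longleftrightarrow>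
     open S \<and> smooth_on f S \<and> (\<forall>z\<in>S. (wirtinger_zbar ^^ n) f z = 0)"

abbreviation unit_disk :: "complex set" where
  "unit_disk \<equiv> ball 0 1"

definition disk_measure :: "real \<Rightarrow> complex measure" where
  "disk_measure \<alpha> = density (restrict_space lborel unit_disk)
     (\<lambda>z. ennreal ((\<alpha> + 1) / pi * (1 - (cmod z)\<^sup>2) powr \<alpha>))"

definition square_integrable :: "'a measure \<Rightarrow> ('a \<Rightarrow> complex) \<Rightarrow> bool" where
  "square_integrable M f \<longleftrightarrow>
     f \<in> borel_measurable M \<and> integrable M (\<lambda>x. (cmod (f x))\<^sup>2)"

definition L2_inner :: "'a measure \<Rightarrow> ('a \<Rightarrow> complex) \<Rightarrow> ('a \<Rightarrow> complex) \<Rightarrow> complex" where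
  "L2_inner M f g = (LINT x|M. f x * cnj (g x))"

definition L2_norm :: "'a measure \<Rightarrow> ('a \<Rightarrow> complex) \<Rightarrow> real" where
  "L2_norm M f = sqrt (LINT x|M. (cmod (f x))\<^sup>2)"

text \<open>Elements are total functions whose values outside the disk are irrelevant. Since they are
  continuous on the disk, almost-everywhere equal elements agree on the whole disk.\<close>

definition n_analytic_Bergman_space :: "nat \<Rightarrow> real \<Rightarrow> (complex \<Rightarrow> complex) set" where
  "n_analytic_Bergman_space n \<alpha> =
     {f. n_analytic_on n f unit_disk \<and> square_integrable (disk_measure \<alpha>) f}"

text \<open>An orthonormal family in the subspace \<open>V\<close> of \<open>L\<^sup>2(M)\<close> whose linear span is dense
  in \<open>V\<close>.\<close>

definition is_orthonormal_basis ::
  "'a measure \<Rightarrow> ('a \<Rightarrow> complex) set \<Rightarrow> 'i set \<Rightarrow> ('i \<Rightarrow> 'a \<Rightarrow> complex) \<Rightarrow> bool" where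
  "is_orthonormal_basis M V I e \<longleftrightarrow>
     (\<forall>i\<in>I. e i \<in> V) \<and>
     (\<forall>i\<in>I. \<forall>j\<in>I. L2_inner M (e i) (e j) = (if i = j then 1 else 0)) \<and>
     (\<forall>f\<in>V. \<forall>\<epsilon>>0. \<exists>F c. finite F \<and> F \<subseteq> I \<and>
        L2_norm M (\<lambda>x. f x - (\<Sum>i\<in>F. c i * e i x)) < \<epsilon>)"

definition disk_poly_coeff :: "real \<Rightarrow> nat \<Rightarrow> nat \<Rightarrow> real" where
  "disk_poly_coeff \<alpha> p q =
     sqrt (((\<alpha> + real p + real q + 1) * Gamma (\<alpha> + real p + 1) * Gamma (\<alpha> + real q + 1)) /
           ((\<alpha> + 1) * fact p * fact q * (Gamma (\<alpha> + real p + real q + 1))\<^sup>2))"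

text \<open>Only the values on the disk matter; there \<open>1 - z * cnj z\<close> is a positive real number.\<close>

definition disk_poly :: "real \<Rightarrow> nat \<Rightarrow> nat \<Rightarrow> complex \<Rightarrow> complex" where
  "disk_poly \<alpha> p q z =
     (-1) ^ (p + q) * complex_of_real (disk_poly_coeff \<alpha> p q) *
     (1 - z * cnj z) powr complex_of_real (- \<alpha>) *
     (wirtinger_z ^^ q) ((wirtinger_zbar ^^ p)
        (\<lambda>w. (1 - w * cnj w) powr complex_of_real (real p + real q + \<alpha>))) z"

end

theory Submission
  imports Defs "HOL-Complex_Analysis.Complex_Analysis"
begin

text \<open>On the disk \<open>b\<^sub>p\<^sub>q\<close> is a polynomial whose leading monomial in \<open>cnj z\<close> is \<open>z\<^sup>p (cnj z)\<^sup>q\<close>.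
  Pairing it with \<open>z\<^sup>a (cnj z)\<^sup>j\<close>, \<open>j \<le> q\<close>, gives zero by rotation invariance unless
  \<open>a - j = p - q\<close>; otherwise, by Beta integrals, it gives a \<open>q\<close>-th finite difference of a polynomial
  of degree \<open>j\<close>, which vanishes for \<open>j < q\<close>. This yields orthonormality. For density, an
  \<open>n\<close>-analytic \<open>f\<close> is \<open>\<Sum>k<n. (cnj z)\<^sup>k g\<^sub>k(z)\<close> with \<open>g\<^sub>k\<close> holomorphic. Its partial sums by angular
  frequency are orthogonal projections of \<open>f\<close> and converge locally uniformly, hence they converge
  in norm, and each monomial \<open>z\<^sup>a (cnj z)\<^sup>b\<close> with \<open>b < n\<close> is a combination of the \<open>b\<^sub>p\<^sub>q\<close> with \<open>q < n\<close>.\<close>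

section \<open>Wirtinger calculus and n-analytic functions\<close>

text \<open>Pairings use the mixed form of the disk polynomial, a sum of terms
  \<open>z^r (cnj z)^k (1 - |z|^2)^(q-k)\<close>: each integrates to a single Beta value whose Gamma
  factors cancel the factorials and Pochhammer symbols in the coefficient. Only
  \<open>(-1)^k (q choose k) (p-q+1+k)_j\<close> still depends on \<open>k\<close>, whence the
  finite difference. The monomial expansion serves to read off the leading coefficient; as all lower
  monomials pair to zero, the squared norm is this coefficient times the pairing with the leading
  monomial, and the normalizing constant makes it 1. The obstacle to density is that the
  \<open>g\<^sub>k\<close> need not be square-integrable separately, so they cannot be approximated
  one at a time. Orthogonality of a partial sum \<open>T\<close> to \<open>f - T\<close> gives
  \<open>|f - T|^2 = |f|^2 - |T|^2\<close> for the norms. Only convergence of norms remains, and for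
  this a disk \<open>|z| < r\<close> carrying nearly all of the norm of \<open>f\<close>
  suffices.\<close>

lemma wirtinger_eqI:
  assumes "(f has_derivative (\<lambda>v. a * v + b * cnj v)) (at z)"
  shows "wirtinger_z f z = a" and "wirtinger_zbar f z = b"
  using frechet_derivative_at[OF assms]
  by (simp_all add: wirtinger_z_def wirtinger_zbar_def fun_eq_iff[symmetric] algebra_simps
      flip: fun_cong[OF frechet_derivative_at[OF assms]])

text \<open>Together with \<open>wirtinger_eqI\<close> this makes the two Wirtinger derivatives
  equivalent to the total derivative: a real-linear map of the plane is
  \<open>a * v + b * cnj v\<close> for unique \<open>a\<close> and \<open>b\<close>, fixed by its
  values \<open>a + b\<close> at 1 and \<open>\<i> * (a - b)\<close> at \<open>\<i>\<close>. Product
  and sum rules then come from the ordinary ones by comparing coefficients.\<close>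

lemma has_derivative_wirtinger:
  assumes "f differentiable (at z)"
  shows "(f has_derivative (\<lambda>v. wirtinger_z f z * v + wirtinger_zbar f z * cnj v)) (at z)"
proof -
  let ?D = "frechet_derivative f (at z)"
  have lin: "linear ?D"
    by (rule linear_frechet_derivative[OF assms])
  have "?D v = wirtinger_z f z * v + wirtinger_zbar f z * cnj v" for v
  proof -
    have "?D v = ?D (Re v *\<^sub>R 1 + Im v *\<^sub>R \<i>)"
      by (simp add: scaleR_conv_of_real mult.commute flip: complex_eq)
    also have "\<dots> = Re v *\<^sub>R ?D 1 + Im v *\<^sub>R ?D \<i>"
      using lin by (simp add: linear_add linear_cmul)
    also have "\<dots> = wirtinger_z f z * (Re v + \<i> * Im v) + wirtinger_zbar f z * (Re v - \<i> * Im v)"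
      by (simp add: wirtinger_z_def wirtinger_zbar_def scaleR_conv_of_real field_simps)
    also have "\<dots> = wirtinger_z f z * v + wirtinger_zbar f z * cnj v"
      by (simp add: complex_eq_iff)
    finally show ?thesis .
  qed
  then have "?D = (\<lambda>v. wirtinger_z f z * v + wirtinger_zbar f z * cnj v)"
    by blast
  with assms show ?thesis
    by (simp add: frechet_derivative_works)
qed

lemma wirtinger_cong:
  assumes "open S" "z \<in> S" "\<And>w. w \<in> S \<Longrightarrow> f w = g w"
  shows "wirtinger_z f z = wirtinger_z g z" "wirtinger_zbar f z = wirtinger_zbar g z"
proof -
  have *: "(f has_derivative D) (at z) \<longleftrightarrow> (g has_derivative D) (at z)" for D
    using assms by (metis has_derivative_transform_within_open)
  then show "wirtinger_z f z = wirtinger_z g z" "wirtinger_zbar f z = wirtinger_zbar g z"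
    by (simp_all add: wirtinger_z_def wirtinger_zbar_def frechet_derivative_def)
qed

lemma wirtinger_funpow_cong:
  assumes "open S" "\<And>w. w \<in> S \<Longrightarrow> f w = g w" "z \<in> S"
  shows "(wirtinger_z ^^ n) f z = (wirtinger_z ^^ n) g z"
    and "(wirtinger_zbar ^^ n) f z = (wirtinger_zbar ^^ n) g z"
  using \<open>z \<in> S\<close>
  by (induction n arbitrary: z) (auto intro: wirtinger_cong[OF \<open>open S\<close>] assms(2))

lemma wirtinger_mult:
  assumes "f differentiable (at z)" "g differentiable (at z)"
  shows "wirtinger_z (\<lambda>w. f w * g w) z = wirtinger_z f z * g z + f z * wirtinger_z g z"
    and "wirtinger_zbar (\<lambda>w. f w * g w) z = wirtinger_zbar f z * g z + f z * wirtinger_zbar g z"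
proof -
  have "((\<lambda>w. f w * g w) has_derivative
      (\<lambda>v. (wirtinger_z f z * g z + f z * wirtinger_z g z) * v
         + (wirtinger_zbar f z * g z + f z * wirtinger_zbar g z) * cnj v)) (at z)"
    by (rule has_derivative_eq_rhs[OF has_derivative_mult[OF assms[THEN has_derivative_wirtinger]]])
      (simp add: algebra_simps)
  from wirtinger_eqI[OF this]
  show "wirtinger_z (\<lambda>w. f w * g w) z = wirtinger_z f z * g z + f z * wirtinger_z g z"
    and "wirtinger_zbar (\<lambda>w. f w * g w) z = wirtinger_zbar f z * g z + f z * wirtinger_zbar g z" .
qed

lemma wirtinger_sum:
  assumes "\<And>i. i \<in> I \<Longrightarrow> f i differentiable (at z)"
  shows "wirtinger_z (\<lambda>w. \<Sum>i\<in>I. f i w) z = (\<Sum>i\<in>I. wirtinger_z (f i) z)"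
    and "wirtinger_zbar (\<lambda>w. \<Sum>i\<in>I. f i w) z = (\<Sum>i\<in>I. wirtinger_zbar (f i) z)"
proof -
  have "((\<lambda>w. \<Sum>i\<in>I. f i w) has_derivative
      (\<lambda>v. (\<Sum>i\<in>I. wirtinger_z (f i) z) * v + (\<Sum>i\<in>I. wirtinger_zbar (f i) z) * cnj v)) (at z)"
    by (rule has_derivative_eq_rhs[OF has_derivative_sum[OF has_derivative_wirtinger[OF assms]]])
      (simp_all add: sum_distrib_right sum.distrib)
  from wirtinger_eqI[OF this]
  show "wirtinger_z (\<lambda>w. \<Sum>i\<in>I. f i w) z = (\<Sum>i\<in>I. wirtinger_z (f i) z)"
    and "wirtinger_zbar (\<lambda>w. \<Sum>i\<in>I. f i w) z = (\<Sum>i\<in>I. wirtinger_zbar (f i) z)" .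
qed

lemma wirtinger_diff:
  assumes "f differentiable (at z)" "g differentiable (at z)"
  shows "wirtinger_zbar (\<lambda>w. f w - g w) z = wirtinger_zbar f z - wirtinger_zbar g z"
proof -
  have "((\<lambda>w. f w - g w) has_derivative
      (\<lambda>v. (wirtinger_z f z - wirtinger_z g z) * v
         + (wirtinger_zbar f z - wirtinger_zbar g z) * cnj v)) (at z)"
    by (rule has_derivative_eq_rhs[OF has_derivative_diff[OF assms[THEN has_derivative_wirtinger]]])
      (simp add: algebra_simps)
  from wirtinger_eqI(2)[OF this] show ?thesis .
qed

lemma wirtinger_field_derivative:
  assumes "(f has_field_derivative d) (at z)"
  shows "wirtinger_z f z = d" "wirtinger_zbar f z = 0" "f differentiable (at z)"
proof -
  from assms have "(f has_derivative (\<lambda>v. d * v + 0 * cnj v)) (at z)"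
    by (simp add: has_field_derivative_def)
  then show "wirtinger_z f z = d" "wirtinger_zbar f z = 0" "f differentiable (at z)"
    by (blast intro: wirtinger_eqI differentiableI)+
qed

text \<open>The form \<open>c * (w ^ a * cnj w ^ b)\<close> serves as a normal form: pure powers are
  written with a zero exponent so that these rules apply. At exponent 0 the truncated subtraction is
  harmless, being multiplied by 0.\<close>

lemma wirtinger_monomial:
  shows "wirtinger_z (\<lambda>w. c * (w ^ a * cnj w ^ b)) z = c * (of_nat a * z ^ (a - 1) * cnj z ^ b)"
    and "wirtinger_zbar (\<lambda>w. c * (w ^ a * cnj w ^ b)) z = c * (of_nat b * z ^ a * cnj z ^ (b - 1))"
    and monomial_differentiable: "(\<lambda>w. c * (w ^ a * cnj w ^ b)) differentiable (at z)"
proof -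
  have "((\<lambda>w. c * (w ^ a * cnj w ^ b)) has_derivative
     (\<lambda>v. (c * (of_nat a * z ^ (a - 1) * cnj z ^ b)) * v
        + (c * (of_nat b * z ^ a * cnj z ^ (b - 1))) * cnj v)) (at z)"
    by (auto intro!: derivative_eq_intros simp: algebra_simps)
  then show "wirtinger_z (\<lambda>w. c * (w ^ a * cnj w ^ b)) z = c * (of_nat a * z ^ (a - 1) * cnj z ^ b)"
    and "wirtinger_zbar (\<lambda>w. c * (w ^ a * cnj w ^ b)) z = c * (of_nat b * z ^ a * cnj z ^ (b - 1))"
    and "(\<lambda>w. c * (w ^ a * cnj w ^ b)) differentiable (at z)"
    by (blast intro: wirtinger_eqI differentiableI)+
qed

section \<open>Closure properties of real smoothness on open sets\<close>

lemma times_differentiable_on_cong: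
  assumes "open S" "\<And>w. w \<in> S \<Longrightarrow> f w = g w" "times_differentiable_on k f S"
  shows "times_differentiable_on k g S"
  using assms(2,3)
proof (induction k arbitrary: f g)
  case 0
  then show ?case
    using continuous_on_cong by force
next
  case (Suc k)
  have *: "(f has_derivative D) (at z) \<longleftrightarrow> (g has_derivative D) (at z)" if "z \<in> S" for D z
    using \<open>open S\<close> Suc.prems(1) that by (metis has_derivative_transform_within_open)
  have fd: "frechet_derivative f (at z) = frechet_derivative g (at z)" if "z \<in> S" for z
    using *[OF that] by (simp add: frechet_derivative_def)
  have "times_differentiable_on k (\<lambda>x. frechet_derivative g (at x) v) S" for v
    by (rule Suc.IH[of "\<lambda>x. frechet_derivative f (at x) v"]) (use Suc.prems fd in auto)
  moreover have "g differentiable (at z)" if "z \<in> S" for z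
    using Suc.prems(2) that *[OF that] unfolding differentiable_def by (metis times_differentiable_on.simps(2) differentiable_def)
  ultimately show ?case
    by simp
qed

text \<open>The formula for the derivative of the sum holds only at points of \<open>S\<close>,
  while the recursion concerns functions on the whole space;
  \<open>times_differentiable_on_cong\<close> bridges the gap.\<close>

lemma times_differentiable_on_add:
  assumes "open S" "times_differentiable_on k f S" "times_differentiable_on k g S"
  shows "times_differentiable_on k (\<lambda>x. f x + g x) S"
  using assms(2,3)
proof (induction k arbitrary: f g)
  case 0
  then show ?case
    by (simp add: continuous_on_add)
next
  case (Suc k)
  have fd: "frechet_derivative (\<lambda>x. f x + g x) (at z)
      = (\<lambda>v. frechet_derivative f (at z) v + frechet_derivative g (at z) v)" if "z \<in> S" for z
    using Suc.prems that
    by (intro frechet_derivative_at[symmetric] has_derivative_add)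
      (auto simp flip: frechet_derivative_works)
  have "times_differentiable_on k (\<lambda>x. frechet_derivative (\<lambda>x. f x + g x) (at x) v) S" for v
    by (rule times_differentiable_on_cong[OF assms(1) _ Suc.IH, rotated, of
          "\<lambda>x. frechet_derivative f (at x) v" "\<lambda>x. frechet_derivative g (at x) v"])
      (use Suc.prems fd in auto)
  then show ?case
    using Suc.prems by simp
qed

lemma times_differentiable_on_cmult:
  fixes f :: "'a::real_normed_vector \<Rightarrow> 'b::real_normed_algebra"
  assumes "open S" "times_differentiable_on k f S"
  shows "times_differentiable_on k (\<lambda>x. c * f x) S"
  using assms(2)
proof (induction k arbitrary: f)
  case 0
  then show ?case
    by (simp add: continuous_on_mult_left)
next
  case (Suc k)
  have fd: "frechet_derivative (\<lambda>x. c * f x) (at z)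
      = (\<lambda>v. c * frechet_derivative f (at z) v)" if "z \<in> S" for z
    using Suc.prems that
    by (intro frechet_derivative_at[symmetric] has_derivative_mult_right)
      (auto simp flip: frechet_derivative_works)
  have "times_differentiable_on k (\<lambda>x. frechet_derivative (\<lambda>x. c * f x) (at x) v) S" for v
    by (rule times_differentiable_on_cong[OF assms(1) _ Suc.IH, rotated, of
          "\<lambda>x. frechet_derivative f (at x) v"])
      (use Suc.prems fd in auto)
  then show ?case
    using Suc.prems by simp
qed

text \<open>A directional derivative of a monomial is a combination of two monomials with new
  coefficients, so the induction runs over all \<open>a\<close>, \<open>b\<close> and
  \<open>c\<close>.\<close>

lemma times_differentiable_on_monomial:
  assumes "open S"
  shows "times_differentiable_on k (\<lambda>z. c * (z ^ a * cnj z ^ b)) S"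
proof (induction k arbitrary: a b c)
  case 0
  then show ?case
    by (auto intro!: continuous_intros)
next
  case (Suc k)
  have "(\<lambda>z. frechet_derivative (\<lambda>z. c * (z ^ a * cnj z ^ b)) (at z) v)
    = (\<lambda>z. c * of_nat a * v * (z ^ (a - 1) * cnj z ^ b) + c * of_nat b * cnj v * (z ^ a * cnj z ^ (b - 1)))"
    for v
  proof
    fix z
    show "frechet_derivative (\<lambda>z. c * (z ^ a * cnj z ^ b)) (at z) v
      = c * of_nat a * v * (z ^ (a - 1) * cnj z ^ b) + c * of_nat b * cnj v * (z ^ a * cnj z ^ (b - 1))"
      using fun_cong[OF frechet_derivative_at[OF has_derivative_wirtinger[OF
            monomial_differentiable[of c a b z]]], of v, symmetric]
      by (simp only: wirtinger_monomial) (simp add: algebra_simps)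
  qed
  then show ?case
    using Suc monomial_differentiable by (simp add: times_differentiable_on_add[OF assms])
qed

lemma times_differentiable_on_sum:
  fixes f :: "'i \<Rightarrow> complex \<Rightarrow> complex"
  assumes "open S" "finite I" "\<And>i. i \<in> I \<Longrightarrow> times_differentiable_on k (f i) S"
  shows "times_differentiable_on k (\<lambda>x. \<Sum>i\<in>I. f i x) S"
  using assms(2,3)
proof (induction I)
  case empty
  show ?case
    using times_differentiable_on_monomial[OF \<open>open S\<close>, of k 0 0 0] by simp
next
  case (insert i I)
  then show ?case
    by (simp add: times_differentiable_on_add[OF assms(1)])
qed

lemma smooth_on_wirtinger_zbar:
  assumes "open S" "smooth_on f S"
  shows "smooth_on (wirtinger_zbar f) S"
  unfolding smooth_on_def
proof
  fix k
  have *: "times_differentiable_on k (\<lambda>x. frechet_derivative f (at x) v) S" for v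
    using assms(2) unfolding smooth_on_def by (metis times_differentiable_on.simps(2))
  have "times_differentiable_on k (\<lambda>z. (1/2) * (frechet_derivative f (at z) 1
      + \<i> * frechet_derivative f (at z) \<i>)) S"
    by (intro times_differentiable_on_cmult times_differentiable_on_add assms *)
  then show "times_differentiable_on k (wirtinger_zbar f) S"
    by (simp add: wirtinger_zbar_def[abs_def])
qed

lemma smooth_on_differentiable:
  assumes "smooth_on f S" "z \<in> S"
  shows "f differentiable (at z)"
  using assms unfolding smooth_on_def by (metis times_differentiable_on.simps(2))

lemma holomorphic_on_wirtinger_zbar:
  assumes "open S" "\<And>z. z \<in> S \<Longrightarrow> f differentiable (at z)" "\<And>z. z \<in> S \<Longrightarrow> wirtinger_zbar f z = 0"
  shows "f holomorphic_on S"
  unfolding holomorphic_on_open[OF \<open>open S\<close>]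
proof
  fix z assume "z \<in> S"
  then have "(f has_derivative (\<lambda>v. wirtinger_z f z * v)) (at z)"
    using has_derivative_wirtinger[OF assms(2), of z] assms(3)[of z] by simp
  then show "\<exists>d. (f has_field_derivative d) (at z)"
    unfolding has_field_derivative_def by blast
qed

text \<open>Antidifferentiating \<open>wirtinger_zbar f\<close> term by term leaves a remainder that is holomorphic.\<close>

lemma n_analytic_decomposition:
  assumes "open S" "smooth_on f S" "\<And>z. z \<in> S \<Longrightarrow> (wirtinger_zbar ^^ n) f z = 0"
  shows "\<exists>g. (\<forall>k<n. g k holomorphic_on S) \<and> (\<forall>z\<in>S. f z = (\<Sum>k<n. cnj z ^ k * g k z))"
  using assms(2,3)
proof (induction n arbitrary: f)
  case 0
  then show ?case
    by simp
next
  case (Suc n)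
  obtain h where h: "\<And>k. k < n \<Longrightarrow> h k holomorphic_on S"
      and f': "\<And>z. z \<in> S \<Longrightarrow> wirtinger_zbar f z = (\<Sum>k<n. cnj z ^ k * h k z)"
    using Suc.IH[of "wirtinger_zbar f"] Suc.prems smooth_on_wirtinger_zbar[OF \<open>open S\<close>]
    by (auto simp: funpow_Suc_right simp del: funpow.simps(2)) blast
  \<comment> \<open>An antiderivative of \<open>cnj z ^ k * h k z\<close> with respect to
    \<open>cnj z\<close>: the holomorphic factor \<open>h k\<close> behaves as a constant for
    \<open>wirtinger_zbar\<close>.\<close>
  define G where "G k z = 1 / of_nat (Suc k) * (z ^ 0 * cnj z ^ Suc k) * h k z" for k z
  have dh: "h k differentiable (at z)" "wirtinger_zbar (h k) z = 0" if "k < n" "z \<in> S" for k z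
    using h[OF that(1)] that(2) \<open>open S\<close> holomorphic_derivI wirtinger_field_derivative by blast+
  have dG: "G k differentiable (at z)" "wirtinger_zbar (G k) z = cnj z ^ k * h k z"
    if "k < n" "z \<in> S" for k z
  proof -
    show "G k differentiable (at z)"
      unfolding G_def by (intro differentiable_mult[OF monomial_differentiable dh(1)[OF that]])
    show "wirtinger_zbar (G k) z = cnj z ^ k * h k z"
      unfolding G_def
      by (subst wirtinger_mult(2)[OF monomial_differentiable dh(1)[OF that]])
        (simp only: wirtinger_monomial dh(2)[OF that], simp del: of_nat_Suc)
  qed
  have df: "f differentiable (at z)" if "z \<in> S" for z
    using Suc.prems(1) that by (rule smooth_on_differentiable)
  define g where "g z = f z - (\<Sum>k<n. G k z)" for z
  have "g holomorphic_on S"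
  proof (rule holomorphic_on_wirtinger_zbar[OF \<open>open S\<close>])
    fix z assume z: "z \<in> S"
    have dS: "(\<lambda>z. \<Sum>k<n. G k z) differentiable (at z)"
      using dG z by (intro differentiable_sum) auto
    then show "g differentiable (at z)"
      unfolding g_def using df[OF z] by (intro differentiable_diff)
    show "wirtinger_zbar g z = 0"
    proof -
      have "wirtinger_zbar (\<lambda>w. \<Sum>k<n. G k w) z = (\<Sum>k<n. wirtinger_zbar (G k) z)"
        by (rule wirtinger_sum(2)) (simp add: dG z)
      then show ?thesis
        unfolding g_def using dG(2)[OF _ z] by (simp add: wirtinger_diff[OF df[OF z] dS] f'[OF z])
    qed
  qed
  \<comment> \<open>Antidifferentiation shifts the coefficients by one place; the holomorphic
    remainder \<open>g\<close> fills place 0.\<close>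
  define g' where "g' k = (case k of 0 \<Rightarrow> g | Suc j \<Rightarrow> (\<lambda>z. 1 / of_nat (Suc j) * h j z))" for k
  have "g' k holomorphic_on S" if "k < Suc n" for k
    using that h \<open>g holomorphic_on S\<close>
    by (auto simp: g'_def split: nat.splits intro!: holomorphic_intros)
  moreover have "f z = (\<Sum>k<Suc n. cnj z ^ k * g' k z)" for z
    by (simp add: sum.lessThan_Suc_shift g'_def g_def G_def algebra_simps del: sum.lessThan_Suc)
  ultimately show ?case
    by blast
qed

section \<open>Disk polynomials as polynomials in z and its conjugate\<close>

text \<open>Each factor is given as its whole sequence of successive derivatives, so
  differentiability of every iterate is part of the data and Pascal's rule does the rest.\<close>

lemma wirtinger_z_leibniz:
  assumes "open S"
    and u: "\<And>i w. w \<in> S \<Longrightarrow> u i differentiable (at w)"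
           "\<And>i w. w \<in> S \<Longrightarrow> wirtinger_z (u i) w = u (Suc i) w"
    and v: "\<And>i w. w \<in> S \<Longrightarrow> v i differentiable (at w)"
           "\<And>i w. w \<in> S \<Longrightarrow> wirtinger_z (v i) w = v (Suc i) w"
    and "z \<in> S"
  shows "(wirtinger_z ^^ n) (\<lambda>w. u 0 w * v 0 w) z
    = (\<Sum>k\<le>n. of_nat (n choose k) * (u (n - k) z * v k z))"
  using \<open>z \<in> S\<close>
proof (induction n arbitrary: z)
  case 0
  then show ?case
    by simp
next
  case (Suc n)
  have d: "(\<lambda>w. of_nat (n choose k) * (u (n - k) w * v k w)) differentiable (at z)"
      "(\<lambda>w. u (n - k) w * v k w) differentiable (at z)" for k
    by (intro differentiable_mult u v differentiable_const Suc.prems)+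
  have summand: "wirtinger_z (\<lambda>w. of_nat (n choose k) * (u (n - k) w * v k w)) z
      = of_nat (n choose k) * (u (Suc n - k) z * v k z + u (n - k) z * v (Suc k) z)" if "k \<le> n" for k
    using that
    by (simp add: wirtinger_mult(1)[OF differentiable_const d(2)] wirtinger_mult(1)[OF u(1) v(1)]
        u v Suc.prems Suc_diff_le wirtinger_field_derivative(1)[OF DERIV_const])
  have "(wirtinger_z ^^ Suc n) (\<lambda>w. u 0 w * v 0 w) z
      = wirtinger_z (\<lambda>w. \<Sum>k\<le>n. of_nat (n choose k) * (u (n - k) w * v k w)) z"
    unfolding funpow.simps o_def by (rule wirtinger_cong[OF \<open>open S\<close> Suc.prems Suc.IH])
  also have "\<dots> = (\<Sum>k\<le>n. of_nat (n choose k) * (u (Suc n - k) z * v k z + u (n - k) z * v (Suc k) z))"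
    by (simp add: wirtinger_sum(1)[OF d(1)] summand)
  \<comment> \<open>The summand \<open>k = Suc n\<close> added to the first sum has binomial
    coefficient 0.\<close>
  also have "\<dots> = (\<Sum>k\<le>Suc n. of_nat (n choose k) * (u (Suc n - k) z * v k z))
      + (\<Sum>k\<le>n. of_nat (n choose k) * (u (n - k) z * v (Suc k) z))"
    by (simp add: distrib_left sum.distrib)
  also have "\<dots> = (\<Sum>k\<le>Suc n. of_nat (Suc n choose k) * (u (Suc n - k) z * v k z))"
    unfolding sum.atMost_Suc_shift by (simp add: sum.distrib algebra_simps)
  finally show ?case .
qed

section \<open>Powers of 1 - |z|^2 and their Wirtinger derivatives\<close>

lemma one_minus_mult_cnj: "1 - z * cnj z = complex_of_real (1 - (cmod z)\<^sup>2)"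
  by (simp add: complex_norm_square flip: of_real_power)

lemma in_unit_disk_iff: "z \<in> unit_disk \<longleftrightarrow> (cmod z)\<^sup>2 < 1"
  by (simp add: abs_square_less_1)

abbreviation wpow :: "real \<Rightarrow> complex \<Rightarrow> complex" where
  "wpow s z \<equiv> (1 - z * cnj z) powr complex_of_real s"

lemma wpow_eq:
  assumes "z \<in> unit_disk"
  shows "wpow s z = complex_of_real ((1 - (cmod z)\<^sup>2) powr s)"
  using assms unfolding one_minus_mult_cnj in_unit_disk_iff by (subst powr_of_real) auto

lemma wpow_mult: "z \<in> unit_disk \<Longrightarrow> wpow s z * wpow t z = wpow (s + t) z"
  by (simp add: wpow_eq powr_add)

text \<open>Chain rule with a base that is a positive real on the disk and so avoids the branch cut
  of \<open>powr\<close>. Each derivative lowers the exponent by one, which makes iteration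
  possible.\<close>

lemma wpow_wirtinger:
  assumes "z \<in> unit_disk"
  shows "wirtinger_z (wpow s) z = - of_real s * cnj z * wpow (s - 1) z"
    and "wirtinger_zbar (wpow s) z = - of_real s * z * wpow (s - 1) z"
    and wpow_differentiable: "wpow s differentiable (at z)"
proof -
  have nz: "1 - z * cnj z \<notin> \<real>\<^sub>\<le>\<^sub>0"
    unfolding one_minus_mult_cnj complex_nonpos_Reals_iff using assms[unfolded in_unit_disk_iff]
    by (simp del: of_real_diff)
  have "((\<lambda>x. x powr complex_of_real s) has_derivative
      (*) (of_real s * wpow (s - 1) z)) (at (1 - z * cnj z))"
    using has_field_derivative_powr[OF nz, of "of_real s"] by (simp add: has_field_derivative_def)
  moreover have "((\<lambda>w. 1 - w * cnj w) has_derivative (\<lambda>v. - (v * cnj z + z * cnj v))) (at z)"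
    by (auto intro!: derivative_eq_intros)
  ultimately have "(wpow s has_derivative
      (\<lambda>v. of_real s * wpow (s - 1) z * - (v * cnj z + z * cnj v))) (at z)"
    by (rule has_derivative_compose[rotated, where g = "\<lambda>x. x powr complex_of_real s"])
  then have "(wpow s has_derivative (\<lambda>v. (- of_real s * cnj z * wpow (s - 1) z) * v
      + (- of_real s * z * wpow (s - 1) z) * cnj v)) (at z)"
    by (rule has_derivative_eq_rhs) (simp add: algebra_simps)
  then show "wirtinger_z (wpow s) z = - of_real s * cnj z * wpow (s - 1) z"
    and "wirtinger_zbar (wpow s) z = - of_real s * z * wpow (s - 1) z"
    and "wpow s differentiable (at z)"
    by (blast intro: wirtinger_eqI differentiableI)+
qed

text \<open>Each further derivative multiplies by \<open>z\<close> and by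
  \<open>- (s - p) = - s + p\<close>, the next factor of the Pochhammer symbol; the power of
  \<open>z\<close> already present is holomorphic and is left alone.\<close>

lemma wirtinger_zbar_funpow_wpow:
  assumes "z \<in> unit_disk"
  shows "(wirtinger_zbar ^^ p) (wpow s) z
    = of_real (pochhammer (- s) p) * z ^ p * wpow (s - real p) z"
  using assms
proof (induction p arbitrary: z)
  case 0
  then show ?case
    by simp
next
  case (Suc p)
  have d: "(\<lambda>w. of_real (pochhammer (- s) p) * (w ^ p * cnj w ^ 0)) differentiable (at z)"
    by (rule monomial_differentiable)
  have "(wirtinger_zbar ^^ Suc p) (wpow s) z
      = wirtinger_zbar (\<lambda>w. of_real (pochhammer (- s) p) * (w ^ p * cnj w ^ 0) * wpow (s - real p) w) z"
    unfolding funpow.simps o_def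
    by (rule wirtinger_cong[OF open_ball Suc.prems]) (simp add: Suc.IH)
  also have "\<dots> = of_real (pochhammer (- s) p) * z ^ p
      * (- of_real (s - real p) * z * wpow (s - real p - 1) z)"
    by (subst wirtinger_mult(2)[OF d wpow_differentiable[OF Suc.prems]])
      (simp only: wirtinger_monomial wpow_wirtinger[OF Suc.prems], simp)
  also have "\<dots> = of_real (pochhammer (- s) (Suc p)) * z ^ Suc p * wpow (s - real (Suc p)) z"
    by (simp add: pochhammer_Suc algebra_simps)
  finally show ?case .
qed

text \<open>Leibniz rule for \<open>w ^ p\<close> and \<open>wpow s w\<close>; the powers of
  \<open>cnj w\<close> produced by the second factor are constants for \<open>wirtinger_z\<close>.
  The signed symbol \<open>(-1) ^ i * pochhammer (- real p) i\<close> is the falling factorial of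
  \<open>p\<close>.\<close>

lemma wirtinger_z_funpow_wpow:
  assumes "z \<in> unit_disk"
  shows "(wirtinger_z ^^ q) (\<lambda>w. c * (w ^ p * wpow s w)) z
    = (\<Sum>k\<le>q. c * of_real (real (q choose k) * ((-1) ^ (q - k) * pochhammer (- real p) (q - k))
         * pochhammer (- s) k) * (z ^ (p - (q - k)) * cnj z ^ k * wpow (s - real k) z))"
proof -
  define u where "u i w = c * of_real ((-1) ^ i * pochhammer (- real p) i) * (w ^ (p - i) * cnj w ^ 0)"
    for i and w :: complex
  define v where "v k w = of_real (pochhammer (- s) k) * (w ^ 0 * cnj w ^ k) * wpow (s - real k) w"
    for k w
  have u: "u i differentiable (at w)" "wirtinger_z (u i) w = u (Suc i) w" for i w
  proof -
    show "u i differentiable (at w)"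
      unfolding u_def by (rule monomial_differentiable)
    \<comment> \<open>Beyond \<open>i = p\<close> the Pochhammer symbol vanishes, so truncated and
      real subtraction may be exchanged.\<close>
    have "pochhammer (- real p) i * real (p - i) = pochhammer (- real p) i * (real p - real i)"
      by (cases "i \<le> p") (auto simp: pochhammer_eq_0_iff of_nat_diff)
    then have *: "complex_of_real (pochhammer (- real p) i) * of_nat (p - i)
        = of_real (pochhammer (- real p) i) * (of_nat p - of_nat i)"
      by (metis of_real_diff of_real_mult of_real_of_nat_eq)
    show "wirtinger_z (u i) w = u (Suc i) w"
      unfolding u_def wirtinger_monomial
      using arg_cong[OF *, of "\<lambda>x. c * (-1) ^ i * x * w ^ (p - Suc i)"]
      by (simp add: pochhammer_Suc algebra_simps)
  qed
  have v: "v k differentiable (at w)" "wirtinger_z (v k) w = v (Suc k) w" if "w \<in> unit_disk" for k w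
  proof -
    show "v k differentiable (at w)"
      unfolding v_def
      by (intro differentiable_mult[OF monomial_differentiable wpow_differentiable[OF that]])
    show "wirtinger_z (v k) w = v (Suc k) w"
      unfolding v_def
      by (subst wirtinger_mult(1)[OF monomial_differentiable wpow_differentiable[OF that]])
        (simp only: wirtinger_monomial wpow_wirtinger[OF that],
          simp add: pochhammer_Suc algebra_simps)
  qed
  have "(\<lambda>w. c * (w ^ p * wpow s w)) = (\<lambda>w. u 0 w * v 0 w)"
    by (simp add: u_def v_def mult.assoc)
  then show ?thesis
    using wirtinger_z_leibniz[where u = u and v = v, OF open_ball u v assms]
    by (simp add: u_def v_def algebra_simps)
qed

text \<open>Each summand with \<open>q - k > p\<close> vanishes, so the truncated exponent \<open>p - (q - k)\<close> is harmless.\<close>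

definition disk_poly_term :: "real \<Rightarrow> nat \<Rightarrow> nat \<Rightarrow> nat \<Rightarrow> real" where
  "disk_poly_term \<alpha> p q k = (-1) ^ (p + q) * disk_poly_coeff \<alpha> p q
     * pochhammer (- (real p + real q + \<alpha>)) p
     * (real (q choose k) * ((-1) ^ (q - k) * pochhammer (- real p) (q - k))
         * pochhammer (- (real q + \<alpha>)) k)"

lemma disk_poly_term_eq_0: "q - k > p \<Longrightarrow> disk_poly_term \<alpha> p q k = 0"
  by (auto simp: disk_poly_term_def pochhammer_eq_0_iff)

text \<open>The prefactor \<open>wpow (- \<alpha>) z\<close> removes \<open>\<alpha>\<close> from
  the exponent \<open>q + \<alpha> - k\<close>, leaving the natural power \<open>q - k\<close> of
  \<open>1 - z * cnj z\<close>.\<close>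

lemma disk_poly_eq:
  assumes "z \<in> unit_disk"
  shows "disk_poly \<alpha> p q z = (\<Sum>k\<le>q. of_real (disk_poly_term \<alpha> p q k)
           * (z ^ (p - (q - k)) * cnj z ^ k * (1 - z * cnj z) ^ (q - k)))"
proof -
  define C where "C = (-1) ^ (p + q) * complex_of_real (disk_poly_coeff \<alpha> p q)"
  define P where "P = complex_of_real (pochhammer (- (real p + real q + \<alpha>)) p)"
  define Q where "Q k = complex_of_real (real (q choose k)
      * ((-1) ^ (q - k) * pochhammer (- real p) (q - k)) * pochhammer (- (real q + \<alpha>)) k)" for k
  have w: "wpow (- \<alpha>) z * wpow (real q + \<alpha> - real k) z = (1 - z * cnj z) ^ (q - k)" if "k \<le> q" for k
  proof -
    have "1 - (cmod z)\<^sup>2 > 0"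
      using assms[unfolded in_unit_disk_iff] by simp
    then have "(1 - (cmod z)\<^sup>2) powr (real q - real k) = (1 - (cmod z)\<^sup>2) ^ (q - k)"
      using that by (simp add: powr_realpow flip: of_nat_diff)
    moreover have "- \<alpha> + (real q + \<alpha> - real k) = real q - real k"
      by simp
    ultimately show ?thesis
      using wpow_mult[OF assms, of "- \<alpha>" "real q + \<alpha> - real k"]
        wpow_eq[OF assms, of "real q - real k"]
      by (simp only: one_minus_mult_cnj of_real_power)
  qed
  have "(wirtinger_z ^^ q) ((wirtinger_zbar ^^ p) (wpow (real p + real q + \<alpha>))) z
      = (wirtinger_z ^^ q) (\<lambda>w. P * (w ^ p * wpow (real q + \<alpha>) w)) z"
  proof (rule wirtinger_funpow_cong[OF open_ball _ assms])
    fix w assume w: "w \<in> unit_disk"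
    have "real p + real q + \<alpha> - real p = real q + \<alpha>"
      by simp
    with wirtinger_zbar_funpow_wpow[OF w, of p "real p + real q + \<alpha>"]
    show "(wirtinger_zbar ^^ p) (wpow (real p + real q + \<alpha>)) w = P * (w ^ p * wpow (real q + \<alpha>) w)"
      by (simp only: P_def mult.assoc)
  qed
  also have "\<dots> = (\<Sum>k\<le>q. P * Q k * (z ^ (p - (q - k)) * cnj z ^ k * wpow (real q + \<alpha> - real k) z))"
    unfolding Q_def by (rule wirtinger_z_funpow_wpow[OF assms])
  finally have "disk_poly \<alpha> p q z = C * wpow (- \<alpha>) z
      * (\<Sum>k\<le>q. P * Q k * (z ^ (p - (q - k)) * cnj z ^ k * wpow (real q + \<alpha> - real k) z))"
    by (simp add: disk_poly_def C_def)
  also have "\<dots> = (\<Sum>k\<le>q. C * P * Q k * (z ^ (p - (q - k)) * cnj z ^ k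
      * (wpow (- \<alpha>) z * wpow (real q + \<alpha> - real k) z)))"
    by (simp add: sum_distrib_left mult_ac)
  also have "\<dots> = (\<Sum>k\<le>q. C * P * Q k * (z ^ (p - (q - k)) * cnj z ^ k * (1 - z * cnj z) ^ (q - k)))"
    using w by simp
  finally show ?thesis
    by (simp add: C_def P_def Q_def disk_poly_term_def)
qed


text \<open>Coefficient of \<open>cnj z ^ j\<close> once every
  \<open>(1 - z * cnj z) ^ (q - k)\<close> is expanded binomially; the \<open>k\<close>-th term
  enters through the binomial index \<open>j - k\<close>.\<close>

definition disk_poly_monom :: "real \<Rightarrow> nat \<Rightarrow> nat \<Rightarrow> nat \<Rightarrow> real" where
  "disk_poly_monom \<alpha> p q j
    = (\<Sum>k\<le>j. disk_poly_term \<alpha> p q k * (real (q - k choose (j - k)) * (-1) ^ (j - k)))"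

lemma disk_poly_eq_monomials:
  assumes "z \<in> unit_disk"
  shows "disk_poly \<alpha> p q z
    = (\<Sum>j\<le>q. of_real (disk_poly_monom \<alpha> p q j) * (z ^ (p - (q - j)) * cnj z ^ j))"
proof -
  define A where "A k = complex_of_real (disk_poly_term \<alpha> p q k)" for k
  define B where "B n i = complex_of_real (real (n choose i) * (-1) ^ i)" for n i
  have binom: "(1 - z * cnj z) ^ n = (\<Sum>i\<le>n. B n i * (z ^ i * cnj z ^ i))" for n
    using binomial_ring[of "- (z * cnj z)" 1 n]
    by (simp add: B_def power_mult_distrib power_minus[of "z * cnj z"] mult_ac)
  have "disk_poly \<alpha> p q z = (\<Sum>k\<le>q. \<Sum>i\<le>q - k. A k * B (q - k) i
      * (z ^ (p - (q - k) + i) * cnj z ^ (k + i)))"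
    unfolding disk_poly_eq[OF assms] binom A_def
    by (simp add: sum_distrib_left power_add mult_ac)
  also have "\<dots> = (\<Sum>(k, i) \<in> {(k, i). k + i \<le> q}. A k * B (q - k) i
      * (z ^ (p - (q - k) + i) * cnj z ^ (k + i)))"
    by (subst sum.Sigma) (auto intro!: sum.cong)
  also have "\<dots> = (\<Sum>j\<le>q. \<Sum>k\<le>j. A k * B (q - k) (j - k)
      * (z ^ (p - (q - k) + (j - k)) * cnj z ^ (k + (j - k))))"
    by (rule sum.triangle_reindex_eq)
  also have "\<dots> = (\<Sum>j\<le>q. \<Sum>k\<le>j. A k * B (q - k) (j - k) * (z ^ (p - (q - j)) * cnj z ^ j))"
  proof (intro sum.cong refl)
    fix j k assume "j \<in> {..q}" "k \<in> {..j}"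
    \<comment> \<open>The exponents recombine only if \<open>p - (q - k)\<close> is a genuine
      difference; otherwise the coefficient is 0.\<close>
    then have "p - (q - k) + (j - k) = p - (q - j)" if "q - k \<le> p"
      using that by auto
    moreover have "k + (j - k) = j"
      using \<open>k \<in> {..j}\<close> by simp
    moreover have "A k = 0" if "\<not> q - k \<le> p"
      using that by (simp add: A_def disk_poly_term_eq_0)
    ultimately show "A k * B (q - k) (j - k) * (z ^ (p - (q - k) + (j - k)) * cnj z ^ (k + (j - k)))
        = A k * B (q - k) (j - k) * (z ^ (p - (q - j)) * cnj z ^ j)"
      by (cases "q - k \<le> p") simp_all
  qed
  also have "\<dots> = (\<Sum>j\<le>q. of_real (disk_poly_monom \<alpha> p q j) * (z ^ (p - (q - j)) * cnj z ^ j))"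
    by (simp add: disk_poly_monom_def A_def B_def sum_distrib_right)
  finally show ?thesis .
qed

text \<open>At \<open>j = q\<close> the signs from the binomial expansion cancel those in
  \<open>disk_poly_term\<close>, and the remaining sum over \<open>k\<close> is the Chu-Vandermonde
  convolution of two Pochhammer symbols.\<close>

lemma disk_poly_monom_leading:
  "disk_poly_monom \<alpha> p q q = (-1) ^ (p + q) * disk_poly_coeff \<alpha> p q
     * pochhammer (- (real p + real q + \<alpha>)) p * pochhammer (- (real p + real q + \<alpha>)) q"
proof -
  define C where "C = (-1) ^ (p + q) * disk_poly_coeff \<alpha> p q * pochhammer (- (real p + real q + \<alpha>)) p"
  have sq: "(-1) ^ i * (-1) ^ i = (1 :: real)" for i
    by (simp flip: power_add)
  have "disk_poly_monom \<alpha> p q q = (\<Sum>k\<le>q. C * (real (q choose k)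
      * pochhammer (- (real q + \<alpha>)) k * pochhammer (- real p) (q - k)) * ((-1) ^ (q - k) * (-1) ^ (q - k)))"
    unfolding disk_poly_monom_def disk_poly_term_def C_def by (simp add: mult_ac)
  also have "\<dots> = C * pochhammer (- (real q + \<alpha>) + - real p) q"
    unfolding sq pochhammer_binomial_sum by (simp add: sum_distrib_left)
  also have "- (real q + \<alpha>) + - real p = - (real p + real q + \<alpha>)"
    by simp
  finally show ?thesis
    by (simp add: C_def)
qed

section \<open>The weighted measure on the disk\<close>

definition vec_of_complex :: "complex \<Rightarrow> real ^ 2" where
  "vec_of_complex z = vector [Re z, Im z]"

definition complex_of_vec :: "real ^ 2 \<Rightarrow> complex" where
  "complex_of_vec x = Complex (x $ 1) (x $ 2)"

lemma complex_of_vec_inverse [simp]: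
  "complex_of_vec (vec_of_complex z) = z" "vec_of_complex (complex_of_vec x) = x"
  by (simp_all add: complex_of_vec_def vec_of_complex_def vec_eq_iff forall_2)

lemma linear_vec_of_complex: "linear vec_of_complex"
  by (rule linearI) (simp_all add: vec_of_complex_def vec_eq_iff forall_2)

lemma linear_complex_of_vec: "linear complex_of_vec"
  by (rule linearI) (simp_all add: complex_of_vec_def complex_eq_iff)

lemma norm_vec_of_complex: "norm (vec_of_complex z) = norm z"
  by (simp add: vec_of_complex_def norm_vec_def L2_set_def UNIV_2 cmod_def)

lemma norm_complex_of_vec: "norm (complex_of_vec x) = norm x"
  by (metis complex_of_vec_inverse(2) norm_vec_of_complex)

lemma measurable_complex_of_vec [measurable]:
  "complex_of_vec \<in> borel_measurable borel" "vec_of_complex \<in> borel_measurable borel"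
  using linear_vec_of_complex linear_complex_of_vec
  by (auto intro!: borel_measurable_continuous_onI linear_continuous_on
      simp flip: linear_conv_bounded_linear)

text \<open>\<open>lborel\<close> is determined by boxes, and the coordinate map takes boxes to
  boxes with equal side lengths.\<close>

lemma distr_lborel_complex_of_vec: "distr lborel borel complex_of_vec = lborel"
proof (rule lborel_eqI[symmetric])
  fix l u :: complex
  assume le: "\<And>b. b \<in> Basis \<Longrightarrow> l \<bullet> b \<le> u \<bullet> b"
  have le': "Re l \<le> Re u" "Im l \<le> Im u"
    using le[of 1] le[of \<i>] by (simp_all add: Basis_complex_def)
  have Basis2: "(Basis :: (real ^ 2) set) = {axis 1 1, axis 2 1}"
    by (auto simp: Basis_vec_def UNIV_2)
  have "complex_of_vec -` box l u = box (vec_of_complex l) (vec_of_complex u)"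
    by (auto simp: complex_of_vec_def vec_of_complex_def in_box_complex_iff mem_box_cart forall_2)
  then have "emeasure (distr lborel borel complex_of_vec) (box l u)
      = emeasure lborel (box (vec_of_complex l) (vec_of_complex u))"
    by (simp add: emeasure_distr)
  also have "\<dots> = (\<Prod>b\<in>Basis. (vec_of_complex u - vec_of_complex l) \<bullet> b)"
    using le' by (intro emeasure_lborel_box) (auto simp: Basis2 vec_of_complex_def inner_axis)
  also have "\<dots> = (\<Prod>b\<in>Basis. (u - l) \<bullet> b)"
    by (simp add: Basis2 Basis_complex_def vec_of_complex_def inner_axis axis_eq_axis)
  finally show "emeasure (distr lborel borel complex_of_vec) (box l u) = (\<Prod>b\<in>Basis. (u - l) \<bullet> b)" .
qed simp

text \<open>The preimage of a box is its image under the inverse map, which is again orthogonal and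
  so preserves Lebesgue measure; boxes determine \<open>lborel\<close>.\<close>

lemma distr_lborel_orthogonal:
  fixes f :: "real ^ 'n::{finite,wellorder} \<Rightarrow> real ^ 'n::_"
  assumes f: "orthogonal_transformation f"
  shows "distr lborel borel f = lborel"
proof (rule lborel_eqI[symmetric])
  fix l u :: "real ^ 'n::_"
  assume le: "\<And>b. b \<in> Basis \<Longrightarrow> l \<bullet> b \<le> u \<bullet> b"
  have [measurable]: "f \<in> borel_measurable borel"
    using f by (intro borel_measurable_continuous_onI linear_continuous_on)
      (simp add: orthogonal_transformation_linear flip: linear_conv_bounded_linear)
  have bij: "bij f" and inv: "orthogonal_transformation (inv f)"
    using f by (simp_all add: orthogonal_transformation_bij orthogonal_transformation_inv)
  have vim: "f -` box l u = inv f ` box l u"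
    using bij by (simp add: bij_vimage_eq_inv_image)
  have box: "box l u \<in> lmeasurable"
    by simp
  have meas: "f -` box l u \<in> sets borel"
    using measurable_sets[of f borel borel "box l u"] by simp
  have "emeasure (distr lborel borel f) (box l u) = emeasure lborel (f -` box l u)"
    by (simp add: emeasure_distr)
  also have "\<dots> = emeasure lebesgue (inv f ` box l u)"
    using meas unfolding vim by simp
  also have "\<dots> = measure lebesgue (inv f ` box l u)"
    by (rule emeasure_eq_measure2[OF measurable_orthogonal_image[OF inv box]])
  also have "\<dots> = measure lebesgue (box l u)"
    by (simp only: measure_orthogonal_image[OF inv box])
  also have "\<dots> = emeasure lebesgue (box l u)"
    by (rule emeasure_eq_measure2[OF box, symmetric])
  also have "\<dots> = (\<Prod>b\<in>Basis. (u - l) \<bullet> b)"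
    using emeasure_lborel_box[OF le] by simp
  finally show "emeasure (distr lborel borel f) (box l u) = (\<Prod>b\<in>Basis. (u - l) \<bullet> b)" .
qed simp

lemma distr_lborel_rotation:
  fixes \<omega> :: complex
  assumes "cmod \<omega> = 1"
  shows "distr lborel borel (\<lambda>z. \<omega> * z) = lborel"
proof -
  define f where "f x = vec_of_complex (\<omega> * complex_of_vec x)" for x
  have "linear f"
    unfolding f_def
    by (intro linear_compose[OF linear_compose[OF linear_complex_of_vec linear_times]
          linear_vec_of_complex, unfolded o_def])
  moreover have "norm (f x) = norm x" for x
    by (simp add: f_def norm_vec_of_complex norm_mult assms norm_complex_of_vec)
  ultimately have orth: "orthogonal_transformation f"
    by (simp add: orthogonal_transformation)
  have [measurable]: "f \<in> borel_measurable borel"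
    unfolding f_def by measurable
  have "distr lborel borel (\<lambda>z. \<omega> * z)
      = distr (distr lborel borel complex_of_vec) borel (\<lambda>z. \<omega> * z)"
    by (simp only: distr_lborel_complex_of_vec)
  also have "\<dots> = distr (distr lborel borel f) borel complex_of_vec"
    by (simp add: distr_distr o_def f_def)
  also have "\<dots> = lborel"
    by (simp only: distr_lborel_orthogonal[OF orth] distr_lborel_complex_of_vec)
  finally show ?thesis .
qed

lemma sets_disk_measure: "sets (disk_measure \<alpha>) = sets (restrict_space borel unit_disk)"
  by (simp add: disk_measure_def cong: sets_restrict_space_cong)

lemma space_disk_measure [simp]: "space (disk_measure \<alpha>) = unit_disk"
  by (simp add: disk_measure_def space_restrict_space)

lemma borel_measurable_disk_measure:
  "f \<in> borel_measurable (disk_measure \<alpha>) \<longleftrightarrow> f \<in> borel_measurable (restrict_space borel unit_disk)"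
  by (rule arg_cong[of _ _ "\<lambda>M. f \<in> M"], rule measurable_cong_sets) (simp_all add: sets_disk_measure)

lemma borel_measurable_disk_measureI:
  "f \<in> borel_measurable borel \<Longrightarrow> f \<in> borel_measurable (disk_measure \<alpha>)"
  by (simp add: borel_measurable_disk_measure measurable_restrict_space1)

lemma integral_disk_measure:
  fixes f :: "complex \<Rightarrow> 'b::{banach, second_countable_topology}"
  assumes "f \<in> borel_measurable (disk_measure \<alpha>)" and "\<alpha> > -1"
  shows "(LINT z|disk_measure \<alpha>. f z)
    = (LINT z|lborel. indicator unit_disk z *\<^sub>R ((\<alpha> + 1) / pi * (1 - (cmod z)\<^sup>2) powr \<alpha>) *\<^sub>R f z)"
proof -
  have [measurable]: "f \<in> borel_measurable (restrict_space lborel unit_disk)"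
    using assms(1) by (simp add: borel_measurable_disk_measure cong: measurable_cong_sets sets_restrict_space_cong)
  have *: "(\<lambda>z. (\<alpha> + 1) / pi * (1 - (cmod z)\<^sup>2) powr \<alpha>) \<in> borel_measurable (restrict_space lborel unit_disk)"
    by (intro measurable_restrict_space1) simp
  show ?thesis
    unfolding disk_measure_def using assms(2)
    by (subst integral_density[OF _ *]) (auto simp: integral_restrict_space)
qed

lemma borel_measurable_monomial [measurable]:
  "(\<lambda>z :: complex. z ^ a * cnj z ^ b) \<in> borel_measurable borel"
  by (intro borel_measurable_continuous_onI continuous_intros)

lemma unit_disk_measurable [measurable]: "unit_disk \<in> sets borel"
  by simp

text \<open>A suitable rotation preserves measure and weight but changes the sign of the monomial,
  so the integral equals its own negative. The radial factor \<open>h\<close> stands for powers of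
  \<open>1 - |z|^2\<close> as well as for cut-offs to smaller disks.\<close>

lemma integral_disk_measure_radial_monomial_eq_0:
  fixes h :: "real \<Rightarrow> real"
  assumes "\<alpha> > -1" and [measurable]: "h \<in> borel_measurable borel" and "a \<noteq> b"
  shows "(LINT z|disk_measure \<alpha>. of_real (h (cmod z)) * (z ^ a * cnj z ^ b)) = 0"
proof -
  \<comment> \<open>The monomial has angular frequency \<open>a - b\<close>, so this rotation
    multiplies it by \<open>cis pi\<close>.\<close>
  define \<omega> where "\<omega> = cis (pi / (real a - real b))"
  define F where "F z = indicator unit_disk z *\<^sub>R ((\<alpha> + 1) / pi * (1 - (cmod z)\<^sup>2) powr \<alpha>) *\<^sub>R
      (of_real (h (cmod z)) * (z ^ a * cnj z ^ b))" for z
  have [measurable]: "F \<in> borel_measurable borel"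
    unfolding F_def by measurable
  have "\<omega> ^ a * cnj \<omega> ^ b = cis (real a * (pi / (real a - real b)) - real b * (pi / (real a - real b)))"
    by (simp only: \<omega>_def cis_cnj Complex.DeMoivre cis_mult) simp
  also have "real a * (pi / (real a - real b)) - real b * (pi / (real a - real b)) = pi"
    using \<open>a \<noteq> b\<close> by (simp add: divide_simps flip: left_diff_distrib)
  finally have \<omega>: "\<omega> ^ a * cnj \<omega> ^ b = -1"
    by simp
  have rot: "F (\<omega> * z) = - F z" for z
  proof -
    have "(\<omega> * z) ^ a * cnj (\<omega> * z) ^ b = (\<omega> ^ a * cnj \<omega> ^ b) * (z ^ a * cnj z ^ b)"
      by (simp add: power_mult_distrib)
    then show ?thesis
      unfolding F_def \<omega> by (simp add: norm_mult \<omega>_def indicator_def)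
  qed
  have "(LINT z|lborel. F z) = (LINT z|distr lborel borel (\<lambda>z. \<omega> * z). F z)"
    by (simp only: distr_lborel_rotation \<omega>_def norm_cis)
  also have "\<dots> = (LINT z|lborel. F (\<omega> * z))"
    by (rule integral_distr) auto
  also have "\<dots> = - (LINT z|lborel. F z)"
    by (simp add: rot)
  finally have "(LINT z|lborel. F z) = 0"
    by simp
  moreover have "(LINT z|disk_measure \<alpha>. of_real (h (cmod z)) * (z ^ a * cnj z ^ b)) = (LINT z|lborel. F z)"
    unfolding F_def by (rule integral_disk_measure) (auto intro!: borel_measurable_disk_measureI assms)
  ultimately show ?thesis
    by simp
qed

section \<open>Radial integrals as integrals over the unit interval\<close>

lemma emeasure_unit_disk_sq_greater:
  "emeasure lborel (unit_disk \<inter> {z. x < (cmod z)\<^sup>2}) = ennreal (pi * (1 - max 0 (min 1 x)))"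
proof -
  consider "x < 0" | "0 \<le> x" "x < 1" | "1 \<le> x"
    by linarith
  then show ?thesis
  proof cases
    case 1
    have "x < (cmod z)\<^sup>2" for z
      using 1 zero_le_power2[of "cmod z"] by linarith
    then show ?thesis
      using 1 emeasure_ball[of 1 "0 :: complex"] by (simp add: unit_ball_vol_2)
  next
    case 2
    have "cmod z \<le> sqrt x \<longleftrightarrow> (cmod z)\<^sup>2 \<le> x" for z
      using 2 by (metis abs_norm_cancel real_sqrt_abs real_sqrt_le_iff)
    then have eq: "unit_disk \<inter> {z. x < (cmod z)\<^sup>2} = unit_disk - cball 0 (sqrt x)"
      by (auto simp: not_le)
    have "sqrt x < 1"
      using 2 by simp
    then have sub: "cball 0 (sqrt x) \<subseteq> unit_disk"
      by (simp only: cball_subset_ball_iff) simp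
    have "emeasure lborel (unit_disk - cball (0::complex) (sqrt x))
        = emeasure lborel unit_disk - emeasure lborel (cball (0::complex) (sqrt x))"
      by (rule emeasure_Diff) (use sub emeasure_cball[of "sqrt x" "0::complex"] 2 in auto)
    also have "\<dots> = ennreal (pi - pi * x)"
      using 2 by (simp add: emeasure_ball emeasure_cball unit_ball_vol_2 ennreal_minus)
    finally show ?thesis
      using 2 eq by (simp add: algebra_simps)
  next
    case 3
    have "unit_disk \<inter> {z. x < (cmod z)\<^sup>2} = {}"
      using 3 unfolding set_eq_iff Int_iff in_unit_disk_iff by auto
    then show ?thesis
      using 3 by simp
  qed
qed

text \<open>The annulus \<open>x < |z|^2 < 1\<close> has area \<open>pi * (1 - x)\<close>, linear in
  \<open>x\<close>, so the squared modulus is uniformly distributed with total mass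
  \<open>pi\<close>. This takes the place of polar coordinates; half-lines \<open>{x<..}\<close> are
  enough to identify the two measures.\<close>

lemma distr_unit_disk_sq:
  "distr (density lborel (indicator unit_disk)) borel (\<lambda>z. (cmod z)\<^sup>2)
    = density lborel (\<lambda>t. ennreal (pi * indicator {0<..<1} t))"
proof (rule measure_eqI_lessThan)
  fix x :: real
  have *: "emeasure (distr (density lborel (indicator unit_disk)) borel (\<lambda>z. (cmod z)\<^sup>2)) {x<..}
      = ennreal (pi * (1 - max 0 (min 1 x)))"
  proof -
    have "emeasure (distr (density lborel (indicator unit_disk)) borel (\<lambda>z. (cmod z)\<^sup>2)) {x<..}
        = emeasure (density lborel (indicator unit_disk)) {z. x < (cmod z)\<^sup>2}"
      by (subst emeasure_distr) (auto simp: vimage_def)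
    also have "\<dots> = emeasure lborel (unit_disk \<inter> {z. x < (cmod z)\<^sup>2})"
      by (subst emeasure_density) (auto simp: indicator_inter_arith[symmetric] nn_integral_indicator)
    finally show ?thesis
      by (simp only: emeasure_unit_disk_sq_greater)
  qed
  then show "emeasure (distr (density lborel (indicator unit_disk)) borel (\<lambda>z. (cmod z)\<^sup>2)) {x<..} < \<infinity>"
    by simp
  have "emeasure (density lborel (\<lambda>t. ennreal (pi * indicator {0<..<1} t))) {x<..}
      = (\<integral>\<^sup>+t. ennreal pi * indicator {max 0 (min 1 x)<..<1} t \<partial>lborel)"
    by (subst emeasure_density) (auto intro!: nn_integral_cong simp: indicator_def)
  also have "\<dots> = ennreal pi * ennreal (1 - max 0 (min 1 x))"
    by (subst nn_integral_cmult_indicator) auto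
  also have "\<dots> = ennreal (pi * (1 - max 0 (min 1 x)))"
    by (simp add: ennreal_mult)
  finally show "emeasure (distr (density lborel (indicator unit_disk)) borel (\<lambda>z. (cmod z)\<^sup>2)) {x<..}
      = emeasure (density lborel (\<lambda>t. ennreal (pi * indicator {0<..<1} t))) {x<..}"
    using * by simp
qed simp_all

text \<open>The weight is itself a function of the squared modulus, so it passes through the
  push-forward; the mass \<open>pi\<close> cancels the normalization \<open>1 / pi\<close>.\<close>

lemma distr_disk_measure_sq:
  assumes "\<alpha> > -1"
  shows "distr (disk_measure \<alpha>) borel (\<lambda>z. (cmod z)\<^sup>2)
    = density lborel (\<lambda>t. ennreal (indicator {0<..<1} t * ((\<alpha> + 1) * (1 - t) powr \<alpha>)))"
proof (rule measure_eqI)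
  fix A :: "real set" assume "A \<in> sets (distr (disk_measure \<alpha>) borel (\<lambda>z. (cmod z)\<^sup>2))"
  then have [measurable]: "A \<in> sets borel"
    by simp
  have [measurable]: "(\<lambda>z. (cmod z)\<^sup>2) \<in> borel_measurable (disk_measure \<alpha>)"
      "(\<lambda>z. (cmod z)\<^sup>2) \<in> borel_measurable (restrict_space lborel unit_disk)"
    by (rule borel_measurable_disk_measureI measurable_restrict_space1; simp)+
  define g where "g t = ennreal ((\<alpha> + 1) / pi * (1 - t) powr \<alpha>) * indicator A t" for t
  have [measurable]: "g \<in> borel_measurable borel"
    unfolding g_def by measurable
  have "emeasure (distr (disk_measure \<alpha>) borel (\<lambda>z. (cmod z)\<^sup>2)) A
      = (\<integral>\<^sup>+z. indicator A ((cmod z)\<^sup>2) \<partial>disk_measure \<alpha>)"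
    by (subst nn_integral_indicator[symmetric], simp, subst nn_integral_distr) auto
  also have "\<dots> = (\<integral>\<^sup>+z. g ((cmod z)\<^sup>2) \<partial>restrict_space lborel unit_disk)"
    unfolding disk_measure_def g_def
    by (subst nn_integral_density) (auto intro!: measurable_restrict_space1)
  also have "\<dots> = (\<integral>\<^sup>+z. indicator unit_disk z * g ((cmod z)\<^sup>2) \<partial>lborel)"
    by (subst nn_integral_restrict_space) (auto simp: mult.commute)
  also have "\<dots> = (\<integral>\<^sup>+t. g t \<partial>distr (density lborel (indicator unit_disk)) borel (\<lambda>z. (cmod z)\<^sup>2))"
    by (simp add: nn_integral_distr nn_integral_density)
  also have "\<dots> = (\<integral>\<^sup>+t. ennreal (pi * indicator {0<..<1} t) * g t \<partial>lborel)"
    unfolding distr_unit_disk_sq by (simp add: nn_integral_density)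
  also have "\<dots> = (\<integral>\<^sup>+t. ennreal (indicator {0<..<1} t * ((\<alpha> + 1) * (1 - t) powr \<alpha>)) * indicator A t \<partial>lborel)"
    unfolding g_def using assms
    by (intro nn_integral_cong) (auto simp: indicator_def ennreal_mult'[symmetric])
  also have "\<dots> = emeasure (density lborel
      (\<lambda>t. ennreal (indicator {0<..<1} t * ((\<alpha> + 1) * (1 - t) powr \<alpha>)))) A"
    by (simp add: emeasure_density)
  finally show "emeasure (distr (disk_measure \<alpha>) borel (\<lambda>z. (cmod z)\<^sup>2)) A = emeasure (density lborel
      (\<lambda>t. ennreal (indicator {0<..<1} t * ((\<alpha> + 1) * (1 - t) powr \<alpha>)))) A" .
qed simp

lemma integral_disk_measure_radial:
  fixes g :: "real \<Rightarrow> real"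
  assumes "\<alpha> > -1" and [measurable]: "g \<in> borel_measurable borel"
  shows "(LINT z|disk_measure \<alpha>. g ((cmod z)\<^sup>2))
      = (\<alpha> + 1) * (LINT t|lborel. indicator {0<..<1} t * ((1 - t) powr \<alpha> * g t))" (is ?thesis1)
    and "integrable (disk_measure \<alpha>) (\<lambda>z. g ((cmod z)\<^sup>2))
      \<longleftrightarrow> integrable lborel (\<lambda>t. indicator {0<..<1} t * ((1 - t) powr \<alpha> * g t))" (is ?thesis2)
proof -
  have [measurable]: "(\<lambda>z. (cmod z)\<^sup>2) \<in> borel_measurable (disk_measure \<alpha>)"
    by (rule borel_measurable_disk_measureI) simp
  have nn: "AE t in lborel. 0 \<le> indicator {0<..<1} t * ((\<alpha> + 1) * (1 - t) powr \<alpha>)"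
    using assms(1) by (auto simp: indicator_def)
  have eq: "(\<lambda>t. indicator {0<..<1} t * ((\<alpha> + 1) * (1 - t) powr \<alpha>) * g t)
      = (\<lambda>t. (\<alpha> + 1) * (indicator {0<..<1} t * ((1 - t) powr \<alpha> * g t)))"
    by auto
  have "(LINT z|disk_measure \<alpha>. g ((cmod z)\<^sup>2))
      = (LINT t|distr (disk_measure \<alpha>) borel (\<lambda>z. (cmod z)\<^sup>2). g t)"
    by (rule integral_distr[symmetric]) auto
  then show ?thesis1
    unfolding distr_disk_measure_sq[OF assms(1)]
    by (simp add: integral_density[OF _ _ nn] eq)
  have "integrable (disk_measure \<alpha>) (\<lambda>z. g ((cmod z)\<^sup>2))
      \<longleftrightarrow> integrable (distr (disk_measure \<alpha>) borel (\<lambda>z. (cmod z)\<^sup>2)) g"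
    by (simp add: integrable_distr_eq)
  then show ?thesis2
    unfolding distr_disk_measure_sq[OF assms(1)] using assms(1)
    by (simp add: integrable_density[OF _ _ nn] eq)
qed

lemma Beta_integral_lborel:
  fixes a b :: real
  assumes "a > 0" "b > 0"
  shows "(LINT t|lborel. indicator {0<..<1} t * (t powr (a - 1) * (1 - t) powr (b - 1))) = Beta a b"
    and "integrable lborel (\<lambda>t. indicator {0<..<1} t * (t powr (a - 1) * (1 - t) powr (b - 1)))"
proof -
  \<comment> \<open>At an endpoint one base is 0 and \<open>0 powr x = 0\<close> for every exponent,
    so the integrands over the open and the closed interval coincide pointwise.\<close>
  have eq: "(\<lambda>t. indicator {0<..<1} t * (t powr (a - 1) * (1 - t) powr (b - 1)))
      = (\<lambda>t. indicator {0..1} t *\<^sub>R (t powr (a - 1) * (1 - t) powr (b - 1)))"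
    by (auto simp: indicator_def fun_eq_iff)
  show "(LINT t|lborel. indicator {0<..<1} t * (t powr (a - 1) * (1 - t) powr (b - 1))) = Beta a b"
    unfolding eq
    using set_borel_integral_eq_integral(2)[OF integrable_Beta[OF assms]]
      integral_unique[OF has_integral_Beta_real[OF assms]]
    by (simp add: set_lebesgue_integral_def)
  show "integrable lborel (\<lambda>t. indicator {0<..<1} t * (t powr (a - 1) * (1 - t) powr (b - 1)))"
    unfolding eq using integrable_Beta[OF assms] by (simp add: set_integrable_def)
qed

lemma integral_disk_measure_sq:
  assumes "\<alpha> > -1"
  shows "(LINT z|disk_measure \<alpha>. ((cmod z)\<^sup>2) ^ a * (1 - (cmod z)\<^sup>2) ^ k)
      = (\<alpha> + 1) * Beta (real a + 1) (real k + \<alpha> + 1)"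
    and "integrable (disk_measure \<alpha>) (\<lambda>z. ((cmod z)\<^sup>2) ^ a * (1 - (cmod z)\<^sup>2) ^ k)"
proof -
  \<comment> \<open>The open interval matters: at \<open>t = 0\<close> with \<open>a = 0\<close> the
    power is 1 while \<open>powr\<close> gives 0.\<close>
  have eq: "(\<lambda>t. indicator {0<..<1} t * ((1 - t) powr \<alpha> * (t ^ a * (1 - t) ^ k)))
      = (\<lambda>t. indicator {0<..<1} t * (t powr (real a + 1 - 1) * (1 - t) powr (real k + \<alpha> + 1 - 1)))"
    by (auto simp: indicator_def fun_eq_iff powr_realpow powr_add)
  have meas: "(\<lambda>t :: real. t ^ a * (1 - t) ^ k) \<in> borel_measurable borel"
    by simp
  show "(LINT z|disk_measure \<alpha>. ((cmod z)\<^sup>2) ^ a * (1 - (cmod z)\<^sup>2) ^ k)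
      = (\<alpha> + 1) * Beta (real a + 1) (real k + \<alpha> + 1)"
    using assms
    by (simp only: integral_disk_measure_radial(1)[OF assms meas] eq)
      (subst Beta_integral_lborel; simp)
  show "integrable (disk_measure \<alpha>) (\<lambda>z. ((cmod z)\<^sup>2) ^ a * (1 - (cmod z)\<^sup>2) ^ k)"
    using assms
    by (simp only: integral_disk_measure_radial(2)[OF assms meas] eq)
      (rule Beta_integral_lborel; simp)
qed

lemma finite_measure_disk_measure:
  assumes "\<alpha> > -1"
  shows "finite_measure (disk_measure \<alpha>)"
proof
  have "integrable (disk_measure \<alpha>) (\<lambda>z. 1 :: real)"
    using integral_disk_measure_sq(2)[OF assms, of 0 0] by simp
  then show "emeasure (disk_measure \<alpha>) (space (disk_measure \<alpha>)) \<noteq> \<infinity>"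
    by (simp add: integrable_iff_bounded less_top)
qed

section \<open>Orthonormality\<close>

text \<open>Up to sign the sum is the \<open>q\<close>-th difference of the degree-\<open>j\<close>
  polynomial \<open>pochhammer x j\<close>. One step is \<open>pochhammer x j - pochhammer (x + 1) j
  = - j * pochhammer (x + 1) (j - 1)\<close>, which lowers both \<open>q\<close> and
  \<open>j\<close>.\<close>

lemma alternating_binomial_sum_pochhammer:
  fixes x :: real
  assumes "j \<le> q"
  shows "(\<Sum>k\<le>q. (-1) ^ k * of_nat (q choose k) * pochhammer (x + of_nat k) j)
    = (if j = q then (-1) ^ q * fact q else 0)"
  using assms
proof (induction q arbitrary: j x)
  case 0
  then show ?case
    by simp
next
  case (Suc q)
  define P where "P k = pochhammer (x + of_nat k) j" for k
  have "(\<Sum>k\<le>Suc q. (-1) ^ k * of_nat (Suc q choose k) * P k)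
      = (\<Sum>k\<le>Suc q. (-1) ^ k * of_nat (q choose k) * P k)
        - (\<Sum>k\<le>q. (-1) ^ k * of_nat (q choose k) * P (Suc k))"
    unfolding sum.atMost_Suc_shift by (simp add: sum.distrib sum_negf sum_subtractf algebra_simps)
  also have "\<dots> = (\<Sum>k\<le>q. (-1) ^ k * of_nat (q choose k) * (P k - P (Suc k)))"
    by (simp add: sum_subtractf right_diff_distrib)
  also have "\<dots> = (\<Sum>k\<le>q. - of_nat j * ((-1) ^ k * of_nat (q choose k)
      * pochhammer (x + 1 + of_nat k) (j - 1)))"
  proof (intro sum.cong refl)
    fix k
    have "P k - P (Suc k) = - of_nat j * pochhammer (x + 1 + of_nat k) (j - 1)"
    proof (cases j)
      case (Suc i)
      have "P k = (x + of_nat k) * pochhammer (x + 1 + of_nat k) i"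
        by (simp add: P_def Suc pochhammer_rec add_ac)
      moreover have "P (Suc k) = (x + 1 + of_nat k + of_nat i) * pochhammer (x + 1 + of_nat k) i"
        by (simp add: P_def Suc pochhammer_rec' add_ac)
      ultimately show ?thesis
        by (simp add: Suc algebra_simps)
    qed (simp add: P_def)
    then show "(-1) ^ k * of_nat (q choose k) * (P k - P (Suc k))
        = - of_nat j * ((-1) ^ k * of_nat (q choose k) * pochhammer (x + 1 + of_nat k) (j - 1))"
      by (simp only: mult_ac)
  qed
  also have "\<dots> = - of_nat j * (\<Sum>k\<le>q. (-1) ^ k * of_nat (q choose k) * pochhammer (x + 1 + of_nat k) (j - 1))"
    by (rule sum_distrib_left[symmetric])
  \<comment> \<open>For \<open>j = 0\<close> the factor in front is 0, whatever the truncated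
    \<open>j - 1\<close> gives.\<close>
  also have "\<dots> = (if j = Suc q then (-1) ^ Suc q * fact (Suc q) else 0)"
    using Suc.prems by (subst Suc.IH) (auto simp: algebra_simps)
  finally show ?case
    by (simp add: P_def)
qed

lemma integrable_disk_measure_bounded:
  fixes f :: "complex \<Rightarrow> 'b::{banach, second_countable_topology}"
  assumes "\<alpha> > -1" "f \<in> borel_measurable (disk_measure \<alpha>)" "\<And>z. z \<in> unit_disk \<Longrightarrow> norm (f z) \<le> B"
  shows "integrable (disk_measure \<alpha>) f"
  by (rule finite_measure.integrable_const_bound[OF finite_measure_disk_measure[OF assms(1)], where B = B])
    (use assms in \<open>auto intro!: AE_I2\<close>)

lemma norm_monomial_le_1: "z \<in> unit_disk \<Longrightarrow> norm (z ^ a * cnj z ^ b) \<le> 1"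
  by (auto simp: norm_mult norm_power intro!: mult_le_one power_le_one)

lemma integrable_disk_measure_monomial:
  assumes "\<alpha> > -1"
  shows "integrable (disk_measure \<alpha>) (\<lambda>z. z ^ a * cnj z ^ b * (1 - z * cnj z) ^ k)"
proof (rule integrable_disk_measure_bounded[OF assms])
  show "(\<lambda>z. z ^ a * cnj z ^ b * (1 - z * cnj z) ^ k) \<in> borel_measurable (disk_measure \<alpha>)"
    by (intro borel_measurable_disk_measureI borel_measurable_continuous_onI continuous_intros)
  fix z :: complex assume z: "z \<in> unit_disk"
  have "norm ((1 - z * cnj z) ^ k) \<le> 1"
    unfolding one_minus_mult_cnj norm_power norm_of_real using z[unfolded in_unit_disk_iff]
    by (intro power_le_one) auto
  then show "norm (z ^ a * cnj z ^ b * (1 - z * cnj z) ^ k) \<le> 1"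
    using norm_monomial_le_1[OF z, of a b] by (subst norm_mult) (intro mult_le_one, simp_all)
qed

text \<open>Rotation kills the case \<open>a \<noteq> b\<close>; for \<open>a = b\<close> the
  integrand is radial. Leaving the power of \<open>1 - z * cnj z\<close> unexpanded yields one Beta
  value in place of an alternating sum.\<close>

lemma integral_disk_measure_monomial:
  assumes "\<alpha> > -1"
  shows "(LINT z|disk_measure \<alpha>. z ^ a * cnj z ^ b * (1 - z * cnj z) ^ k)
    = (if a = b then of_real ((\<alpha> + 1) * Beta (real a + 1) (real k + \<alpha> + 1)) else 0)"
proof (cases "a = b")
  case True
  have "z ^ a * cnj z ^ b * (1 - z * cnj z) ^ k = of_real (((cmod z)\<^sup>2) ^ a * (1 - (cmod z)\<^sup>2) ^ k)" for z
    by (simp only: True of_real_mult of_real_power[of _ b] of_real_power[of _ k] of_real_diff of_real_1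
        complex_norm_square power_mult_distrib)
  then show ?thesis
    using integral_disk_measure_sq(1)[OF assms, of a k] True
    by (simp only: integral_complex_of_real) simp
next
  case False
  have eq: "z ^ a * cnj z ^ b * (1 - z * cnj z) ^ k = of_real ((1 - (cmod z)\<^sup>2) ^ k) * (z ^ a * cnj z ^ b)" for z
    unfolding one_minus_mult_cnj by (simp add: mult.commute)
  have meas: "(\<lambda>r :: real. (1 - r\<^sup>2) ^ k) \<in> borel_measurable borel"
    by simp
  show ?thesis
    by (simp only: eq integral_disk_measure_radial_monomial_eq_0[OF assms meas False] False if_False)
qed

lemma pochhammer_minus_of_nat:
  assumes "m \<le> p"
  shows "(-1) ^ m * pochhammer (- real p) m * fact (p - m) = fact p"
proof -
  have "(-1) ^ m * pochhammer (- real p) m = pochhammer (real (p - m) + 1) m"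
    using assms by (simp add: pochhammer_minus' of_nat_diff power_mult_distrib[symmetric]
        flip: mult.assoc)
  then show ?thesis
    using pochhammer_product'[of "1 :: real" "p - m" m] assms
    by (simp add: pochhammer_fact[symmetric] add.commute mult.commute)
qed

text \<open>By reflection \<open>pochhammer (- s) k\<close> is
  \<open>(-1) ^ k * pochhammer (s - k + 1) k\<close>, a quotient of Gamma values; the hypothesis
  keeps both Gamma arguments positive.\<close>

lemma pochhammer_minus_Gamma:
  fixes s :: real
  assumes "s - real k > -1"
  shows "pochhammer (- s) k * Gamma (s - real k + 1) = (-1) ^ k * Gamma (s + 1)"
proof -
  have "s - real k + 1 \<notin> \<int>\<^sub>\<le>\<^sub>0"
    using assms nonpos_Ints_nonpos by fastforce
  then have "pochhammer (s - real k + 1) k = Gamma (s + 1) / Gamma (s - real k + 1)"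
    by (simp add: pochhammer_Gamma)
  moreover have "Gamma (s - real k + 1) > 0"
    using assms by (intro Gamma_real_pos) simp
  ultimately show ?thesis
    by (simp add: pochhammer_minus field_simps)
qed

text \<open>The part of \<open>disk_poly_term\<close> that does not depend on
  \<open>k\<close>.\<close>

definition disk_poly_factor :: "real \<Rightarrow> nat \<Rightarrow> nat \<Rightarrow> real" where
  "disk_poly_factor \<alpha> p q = (-1) ^ (p + q) * disk_poly_coeff \<alpha> p q
     * pochhammer (- (real p + real q + \<alpha>)) p"

text \<open>The Gamma values in the numerator of \<open>Beta\<close> complete the Pochhammer symbols
  of the coefficient: one restores \<open>fact p\<close> and leaves a rising factorial of length
  \<open>j\<close>, the other restores \<open>Gamma (q + \<alpha> + 1)\<close>. The two arguments
  add up to \<open>p + j + \<alpha> + 2\<close>, so the denominator is free of \<open>k\<close> as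
  well.\<close>

lemma disk_poly_term_Beta:
  assumes "\<alpha> > -1" "k \<le> q" "q \<le> p + j"
  shows "disk_poly_term \<alpha> p q k * Beta (real (p - (q - k) + j) + 1) (real (q - k) + \<alpha> + 1)
    = disk_poly_factor \<alpha> p q * fact p * Gamma (real q + \<alpha> + 1) / Gamma (real p + real j + \<alpha> + 2)
      * ((-1) ^ k * real (q choose k) * pochhammer (real p - real q + 1 + real k) j)"
proof (cases "q - k \<le> p")
  case True
  define m where "m = q - k"
  define T where "T = (-1) ^ m * pochhammer (- real p) m"
  define S where "S = pochhammer (- (real q + \<alpha>)) k"
  have m: "m \<le> p" "real m = real q - real k"
    using True assms(2) by (simp_all add: m_def of_nat_diff)
  have T: "T * fact (p - m) = fact p"
    unfolding T_def by (rule pochhammer_minus_of_nat[OF m(1)])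
  have S: "S * Gamma (real m + \<alpha> + 1) = (-1) ^ k * Gamma (real q + \<alpha> + 1)"
    using pochhammer_minus_Gamma[of "real q + \<alpha>" k] assms(1,2) unfolding S_def m(2)
    by (simp add: algebra_simps)
  have G: "Gamma (real (p - m + j) + 1) = fact (p - m) * pochhammer (real p - real q + 1 + real k) j"
  proof -
    have "real p - real q + 1 + real k = 1 + real (p - m)"
      using m by (simp add: of_nat_diff)
    moreover have "Gamma (real (p - m + j) + 1) = fact (p - m + j)"
      using Gamma_fact[of "p - m + j", where 'a = real] by (simp only: add.commute)
    ultimately show ?thesis
      by (simp only: pochhammer_fact pochhammer_product')
  qed
  have sum: "real (p - m + j) + 1 + (real m + \<alpha> + 1) = real p + real j + \<alpha> + 2"
    using m by (simp add: of_nat_diff)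
  have "disk_poly_term \<alpha> p q k * Beta (real (p - m + j) + 1) (real m + \<alpha> + 1)
      = disk_poly_factor \<alpha> p q * (real (q choose k) * T * S)
        * (fact (p - m) * pochhammer (real p - real q + 1 + real k) j * Gamma (real m + \<alpha> + 1)
           / Gamma (real p + real j + \<alpha> + 2))"
    unfolding disk_poly_term_def Beta_def sum G
    by (simp add: m_def T_def S_def disk_poly_factor_def)
  also have "\<dots> = disk_poly_factor \<alpha> p q * real (q choose k) * (T * fact (p - m))
      * (S * Gamma (real m + \<alpha> + 1)) * pochhammer (real p - real q + 1 + real k) j
      / Gamma (real p + real j + \<alpha> + 2)"
    by simp
  finally show ?thesis
    unfolding T S by (simp add: m_def algebra_simps)
next
  case False
  \<comment> \<open>Here the coefficient is 0, and so is the right side: by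
    \<open>q \<le> p + j\<close> the base is a nonpositive integer above \<open>-j\<close>, so one
    factor of the Pochhammer symbol vanishes.\<close>
  have "real p - real q + 1 + real k = - real (q - k - p - 1)"
    using False assms(2) by (simp add: of_nat_diff)
  moreover have "q - k - p - 1 < j"
    using False assms(3) by simp
  ultimately have "pochhammer (real p - real q + 1 + real k) j = 0"
    unfolding pochhammer_eq_0_iff by blast
  then show ?thesis
    using False disk_poly_term_eq_0[of p q k \<alpha>] by simp
qed

text \<open>The angular part leaves only \<open>p + j = q + a\<close>; the radial part is then a \<open>q\<close>-th finite
  difference of a polynomial of degree \<open>j\<close>.\<close>

lemma disk_poly_inner_monomial:
  assumes "\<alpha> > -1" "j \<le> q"
  shows "L2_inner (disk_measure \<alpha>) (disk_poly \<alpha> p q) (\<lambda>z. z ^ a * cnj z ^ j)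
    = (if j = q \<and> a = p then of_real (disk_poly_factor \<alpha> p q * (\<alpha> + 1) * fact p * (-1) ^ q * fact q
          * Gamma (real q + \<alpha> + 1) / Gamma (real p + real q + \<alpha> + 2)) else 0)"
proof -
  let ?M = "disk_measure \<alpha>"
  define A where "A k = disk_poly_term \<alpha> p q k" for k
  have "L2_inner ?M (disk_poly \<alpha> p q) (\<lambda>z. z ^ a * cnj z ^ j)
      = (LINT z|?M. (\<Sum>k\<le>q. of_real (A k)
          * (z ^ (p - (q - k) + j) * cnj z ^ (k + a) * (1 - z * cnj z) ^ (q - k))))"
    unfolding L2_inner_def A_def
    by (intro Bochner_Integration.integral_cong refl)
      (simp add: disk_poly_eq sum_distrib_right sum_distrib_left power_add mult_ac)
  also have "\<dots> = (\<Sum>k\<le>q. of_real (A k)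
      * (LINT z|?M. z ^ (p - (q - k) + j) * cnj z ^ (k + a) * (1 - z * cnj z) ^ (q - k)))"
    using integrable_disk_measure_monomial[OF assms(1)] by (subst Bochner_Integration.integral_sum) auto
  also have "\<dots> = (\<Sum>k\<le>q. if p + j = q + a
      then of_real ((\<alpha> + 1) * (A k * Beta (real (p - (q - k) + j) + 1) (real (q - k) + \<alpha> + 1))) else 0)"
  proof (intro sum.cong refl)
    fix k assume "k \<in> {..q}"
    then have "p - (q - k) + j = k + a \<longleftrightarrow> p + j = q + a" if "q - k \<le> p"
      using that by auto
    moreover have "A k = 0" if "\<not> q - k \<le> p"
      using that by (simp add: A_def disk_poly_term_eq_0)
    ultimately show "of_real (A k)
        * (LINT z|?M. z ^ (p - (q - k) + j) * cnj z ^ (k + a) * (1 - z * cnj z) ^ (q - k))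
      = (if p + j = q + a then of_real ((\<alpha> + 1) * (A k * Beta (real (p - (q - k) + j) + 1)
           (real (q - k) + \<alpha> + 1))) else 0)"
      unfolding integral_disk_measure_monomial[OF assms(1)] by (cases "q - k \<le> p") auto
  qed
  also have "\<dots> = (if j = q \<and> a = p then of_real (disk_poly_factor \<alpha> p q * (\<alpha> + 1) * fact p * (-1) ^ q * fact q
          * Gamma (real q + \<alpha> + 1) / Gamma (real p + real q + \<alpha> + 2)) else 0)"
  proof (cases "p + j = q + a")
    case True
    define R where "R = disk_poly_factor \<alpha> p q * fact p * Gamma (real q + \<alpha> + 1) / Gamma (real p + real j + \<alpha> + 2)"
    have "(\<Sum>k\<le>q. A k * Beta (real (p - (q - k) + j) + 1) (real (q - k) + \<alpha> + 1))
        = (\<Sum>k\<le>q. R * ((-1) ^ k * real (q choose k) * pochhammer (real p - real q + 1 + real k) j))"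
      unfolding A_def R_def using True assms(1) by (intro sum.cong refl disk_poly_term_Beta) auto
    also have "\<dots> = R * (if j = q then (-1) ^ q * fact q else 0)"
      by (simp only: alternating_binomial_sum_pochhammer[OF assms(2)] flip: sum_distrib_left)
    finally have *: "(\<Sum>k\<le>q. (\<alpha> + 1) * (A k * Beta (real (p - (q - k) + j) + 1) (real (q - k) + \<alpha> + 1)))
        = (\<alpha> + 1) * (R * (if j = q then (-1) ^ q * fact q else 0))"
      by (simp only: flip: sum_distrib_left)
    then show ?thesis
      unfolding True using True by (simp only: refl if_True * flip: of_real_sum) (auto simp: R_def)
  qed auto
  finally show ?thesis .
qed

text \<open>The left side is the squared norm: leading coefficient times pairing with the leading
  monomial. With \<open>s = p + q + \<alpha>\<close> all Pochhammer symbols become Gamma quotients,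
  and \<open>Gamma (s + 2) = (s + 1) * Gamma (s + 1)\<close> accounts for the factor
  \<open>\<alpha> + p + q + 1\<close> in the constant. As a factor of 1, the leading coefficient is
  also nonzero, which the density argument uses.\<close>

lemma disk_poly_coeff_normalizes:
  assumes "\<alpha> > -1"
  shows "disk_poly_monom \<alpha> p q q * (disk_poly_factor \<alpha> p q * (\<alpha> + 1) * fact p * (-1) ^ q * fact q
          * Gamma (real q + \<alpha> + 1) / Gamma (real p + real q + \<alpha> + 2)) = 1"
proof -
  define s where "s = real p + real q + \<alpha>"
  define c where "c = disk_poly_coeff \<alpha> p q"
  define Gp Gq G where "Gp = Gamma (real p + \<alpha> + 1)" "Gq = Gamma (real q + \<alpha> + 1)" "G = Gamma (s + 1)"
  have pos: "Gp > 0" "Gq > 0" "G > 0" "s + 1 > 0"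
    using assms by (auto simp: Gp_Gq_G_def s_def intro!: Gamma_real_pos)
  have "s + 1 \<noteq> 0" "s + 1 \<notin> \<int>\<^sub>\<le>\<^sub>0"
    using pos(4) nonpos_Ints_nonpos by fastforce+
  then have G2: "Gamma (real p + real q + \<alpha> + 2) = (s + 1) * G"
    using Gamma_plus1[of "s + 1"] by (simp add: s_def Gp_Gq_G_def add_ac)
  have c2: "c\<^sup>2 = ((s + 1) * Gp * Gq) / ((\<alpha> + 1) * fact p * fact q * G\<^sup>2)"
    unfolding c_def disk_poly_coeff_def
    using pos assms by (subst real_sqrt_pow2) (auto simp: s_def Gp_Gq_G_def add_ac intro!: divide_nonneg_nonneg mult_nonneg_nonneg)
  have "pochhammer (- s) p * Gq = (-1) ^ p * G"
    using pochhammer_minus_Gamma[of s p] assms by (simp add: s_def Gp_Gq_G_def)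
  then have P: "pochhammer (- s) p = (-1) ^ p * G / Gq"
    using pos by (simp add: field_simps)
  have "pochhammer (- s) q * Gp = (-1) ^ q * G"
    using pochhammer_minus_Gamma[of s q] assms by (simp add: s_def Gp_Gq_G_def)
  then have Q: "pochhammer (- s) q = (-1) ^ q * G / Gp"
    using pos by (simp add: field_simps)
  have sq: "(-1) ^ i * (-1) ^ i = (1 :: real)" for i
    by (simp flip: power_add)
  define t a fp fq where "t = s + 1" "a = \<alpha> + 1" "fp = (fact p :: real)" "fq = (fact q :: real)"
  note folds = t_a_fp_fq_def[symmetric]
  have nz: "t \<noteq> 0" "a \<noteq> 0" "fp \<noteq> 0" "fq \<noteq> 0" "G \<noteq> 0" "Gp \<noteq> 0" "Gq \<noteq> 0"
    using pos assms by (auto simp: t_a_fp_fq_def)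
  have "disk_poly_monom \<alpha> p q q * (disk_poly_factor \<alpha> p q * (\<alpha> + 1) * fact p * (-1) ^ q * fact q
          * Gamma (real q + \<alpha> + 1) / Gamma (real p + real q + \<alpha> + 2))
      = ((-1) ^ (p + q) * c * ((-1) ^ p * G / Gq) * ((-1) ^ q * G / Gp)) * ((-1) ^ (p + q) * c * ((-1) ^ p * G / Gq)
        * a * fp * (-1) ^ q * fq * Gq / (t * G))"
    unfolding disk_poly_monom_leading disk_poly_factor_def G2
    by (simp only: P Q s_def[symmetric] c_def[symmetric] Gp_Gq_G_def[symmetric] folds)
  also have "\<dots> = (((-1) ^ (p + q) * (-1) ^ (p + q)) * ((-1) ^ p * (-1) ^ p) * ((-1) ^ q * (-1) ^ q))
      * (c\<^sup>2 * (G\<^sup>2 * a * fp * fq / (Gp * Gq * t)))"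
    using nz by (simp add: field_simps power2_eq_square)
  also have "\<dots> = 1"
    unfolding sq c2 folds using nz by (simp add: field_simps)
  finally show ?thesis .
qed

lemma L2_inner_cnj: "L2_inner M f g = cnj (L2_inner M g f)"
  unfolding L2_inner_def by (subst Bochner_Integration.integral_cnj[symmetric]) (simp add: mult.commute)

text \<open>By conjugate symmetry take \<open>q' \<le> q\<close> and expand the second factor in
  monomials. All have degree at most \<open>q\<close> in \<open>cnj z\<close>, so only
  \<open>j = q\<close> can pair nontrivially, which forces \<open>q' = q\<close> and then
  \<open>p' = p\<close>.\<close>

lemma disk_poly_orthonormal:
  assumes "\<alpha> > -1"
  shows "L2_inner (disk_measure \<alpha>) (disk_poly \<alpha> p q) (disk_poly \<alpha> p' q')
    = (if p = p' \<and> q = q' then 1 else 0)"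
proof -
  let ?M = "disk_measure \<alpha>"
  have *: "L2_inner ?M (disk_poly \<alpha> p q) (disk_poly \<alpha> p' q') = (if p = p' \<and> q = q' then 1 else 0)"
    if "q' \<le> q" for p q p' q'
  proof -
    define N where "N = disk_poly_factor \<alpha> p q * (\<alpha> + 1) * fact p * (-1) ^ q * fact q
          * Gamma (real q + \<alpha> + 1) / Gamma (real p + real q + \<alpha> + 2)"
    define d where "d j = disk_poly_monom \<alpha> p' q' j" for j
    define e where "e j = p' - (q' - j)" for j
    have int: "integrable ?M (\<lambda>z. disk_poly \<alpha> p q z * cnj (z ^ a * cnj z ^ j))" for a j
    proof -
      have "integrable ?M (\<lambda>z. \<Sum>i\<le>q. of_real (disk_poly_monom \<alpha> p q i)
          * (z ^ (p - (q - i) + j) * cnj z ^ (i + a) * (1 - z * cnj z) ^ 0))"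
        by (intro Bochner_Integration.integrable_sum integrable_mult_right
            integrable_disk_measure_monomial assms)
      then show ?thesis
        by (rule Bochner_Integration.integrable_cong[THEN iffD1, rotated 2])
          (simp_all add: disk_poly_eq_monomials sum_distrib_right sum_distrib_left power_add mult_ac)
    qed
    have "L2_inner ?M (disk_poly \<alpha> p q) (disk_poly \<alpha> p' q')
        = (LINT z|?M. (\<Sum>j\<le>q'. of_real (d j) * (disk_poly \<alpha> p q z * cnj (z ^ e j * cnj z ^ j))))"
      unfolding L2_inner_def
      by (intro Bochner_Integration.integral_cong refl)
        (simp add: disk_poly_eq_monomials[of _ \<alpha> p' q'] sum_distrib_left d_def e_def mult_ac)
    also have "\<dots> = (\<Sum>j\<le>q'. of_real (d j) * L2_inner ?M (disk_poly \<alpha> p q) (\<lambda>z. z ^ e j * cnj z ^ j))"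
      unfolding L2_inner_def using int by (subst Bochner_Integration.integral_sum) auto
    also have "\<dots> = (\<Sum>j\<le>q'. if j = q \<and> e j = p then of_real (d j * N) else 0)"
      using that unfolding N_def
      by (intro sum.cong refl) (subst disk_poly_inner_monomial[OF assms]; auto)
    also have "\<dots> = (if q = q' \<and> p' = p then of_real (d q * N) else 0)"
    proof (cases "q = q'")
      case True
      then have "(\<Sum>j\<le>q'. if j = q \<and> e j = p then of_real (d j * N) else 0)
          = (\<Sum>j\<le>q'. if j = q then (if p' = p then of_real (d q * N) else 0) else (0 :: complex))"
        by (intro sum.cong refl) (auto simp: e_def)
      then show ?thesis
        using True by (simp add: sum.delta)
    next
      case False
      then show ?thesis
        using that by (auto intro!: sum.neutral)
    qed
    also have "\<dots> = (if p = p' \<and> q = q' then 1 else 0)"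
      using disk_poly_coeff_normalizes[OF assms, of p q] by (auto simp: d_def N_def)
    finally show ?thesis .
  qed
  show ?thesis
  proof (cases "q' \<le> q")
    case False
    then have "L2_inner ?M (disk_poly \<alpha> p' q') (disk_poly \<alpha> p q) = (if p' = p \<and> q' = q then 1 else 0)"
      by (intro *) simp
    then show ?thesis
      by (subst L2_inner_cnj) auto
  qed (rule *)
qed

text \<open>Each derivative lowers the exponents of \<open>cnj z\<close>. An exponent that is
  already 0 stays there under truncated subtraction, but its coefficient becomes 0; the alternative
  \<open>c j = 0\<close> records such terms.\<close>

lemma wirtinger_zbar_funpow_monomials_eq_0:
  assumes "finite J" "\<And>j. j \<in> J \<Longrightarrow> b j < n \<or> c j = 0"
  shows "(wirtinger_zbar ^^ n) (\<lambda>z. \<Sum>j\<in>J. c j * (z ^ e j * cnj z ^ b j)) z = 0"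
  using assms(2)
proof (induction n arbitrary: b c)
  case 0
  then show ?case
    by simp
next
  case (Suc n)
  have "wirtinger_zbar (\<lambda>z. \<Sum>j\<in>J. c j * (z ^ e j * cnj z ^ b j))
      = (\<lambda>z. \<Sum>j\<in>J. (c j * of_nat (b j)) * (z ^ e j * cnj z ^ (b j - 1)))"
    by (rule ext) (simp add: wirtinger_sum(2)[OF monomial_differentiable] wirtinger_monomial mult_ac)
  moreover have "b j - 1 < n \<or> c j * of_nat (b j) = 0" if "j \<in> J" for j
    using Suc.prems[OF that] by (cases "b j") auto
  ultimately show ?case
    using Suc.IH[of "\<lambda>j. b j - 1" "\<lambda>j. c j * of_nat (b j)"]
    by (simp add: funpow_Suc_right del: funpow.simps)
qed

lemma continuous_on_disk_measurable:
  "continuous_on unit_disk f \<Longrightarrow> f \<in> borel_measurable (disk_measure \<alpha>)"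
  unfolding borel_measurable_disk_measure by (rule borel_measurable_continuous_on_restrict)

text \<open>Smoothness and \<open>n\<close>-analyticity are proved for the polynomial
  \<open>P\<close> on the plane and transferred by agreement on the open disk. Boundedness on a
  finite measure space gives square-integrability.\<close>

lemma disk_poly_in_space:
  assumes "\<alpha> > -1" "q < n"
  shows "disk_poly \<alpha> p q \<in> n_analytic_Bergman_space n \<alpha>"
proof -
  define d where "d j = complex_of_real (disk_poly_monom \<alpha> p q j)" for j
  define P where "P z = (\<Sum>j\<le>q. d j * (z ^ (p - (q - j)) * cnj z ^ j))" for z
  have eq: "P z = disk_poly \<alpha> p q z" if "z \<in> unit_disk" for z
    using disk_poly_eq_monomials[OF that] by (simp add: P_def d_def)
  have "times_differentiable_on k P unit_disk" for k
    unfolding P_def by (intro times_differentiable_on_sum times_differentiable_on_monomial) auto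
  then have smooth: "smooth_on (disk_poly \<alpha> p q) unit_disk"
    unfolding smooth_on_def using times_differentiable_on_cong[of unit_disk P "disk_poly \<alpha> p q"] eq by auto
  have "(wirtinger_zbar ^^ n) (disk_poly \<alpha> p q) z = 0" if "z \<in> unit_disk" for z
  proof -
    have "(wirtinger_zbar ^^ n) (disk_poly \<alpha> p q) z = (wirtinger_zbar ^^ n) P z"
      by (rule wirtinger_funpow_cong(2)[OF open_ball _ that]) (simp add: eq)
    also have "\<dots> = 0"
      unfolding P_def using assms(2) by (intro wirtinger_zbar_funpow_monomials_eq_0) auto
    finally show ?thesis .
  qed
  moreover have meas: "disk_poly \<alpha> p q \<in> borel_measurable (disk_measure \<alpha>)"
  proof -
    have "continuous_on unit_disk (disk_poly \<alpha> p q)"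
      using smooth unfolding smooth_on_def by (metis times_differentiable_on.simps(1))
    then show ?thesis
      by (rule continuous_on_disk_measurable)
  qed
  moreover have "integrable (disk_measure \<alpha>) (\<lambda>z. (cmod (disk_poly \<alpha> p q z))\<^sup>2)"
  proof (rule integrable_disk_measure_bounded[OF assms(1)])
    show "(\<lambda>z. (cmod (disk_poly \<alpha> p q z))\<^sup>2) \<in> borel_measurable (disk_measure \<alpha>)"
      using meas by measurable
    fix z :: complex assume z: "z \<in> unit_disk"
    have "cmod (disk_poly \<alpha> p q z) \<le> (\<Sum>j\<le>q. cmod (d j))"
      unfolding eq[OF z, symmetric] P_def
      using norm_monomial_le_1[OF z] by (intro sum_norm_le) (auto simp: norm_mult intro!: mult_left_le)
    then show "norm ((cmod (disk_poly \<alpha> p q z))\<^sup>2) \<le> (\<Sum>j\<le>q. cmod (d j))\<^sup>2"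
      by (simp add: power_mono)
  qed
  ultimately show ?thesis
    using smooth by (simp add: n_analytic_Bergman_space_def n_analytic_on_def square_integrable_def)
qed

section \<open>Density\<close>

lemma borel_measurable_cnj [measurable (raw)]:
  "f \<in> borel_measurable M \<Longrightarrow> (\<lambda>x. cnj (f x)) \<in> borel_measurable M"
  by (rule borel_measurable_continuous_on[of cnj]) (auto intro!: continuous_intros)

text \<open>Every point of the disk eventually lies within the radius \<open>m / (m + 1)\<close>,
  and \<open>norm (G z)\<close> dominates. This lifts identities from smaller disks, on which power
  series converge uniformly, to the whole disk.\<close>

lemma integral_disk_measure_exhaust:
  fixes G :: "complex \<Rightarrow> 'b::{banach, second_countable_topology}"
  assumes "integrable (disk_measure \<alpha>) G"
  shows "(\<lambda>m. LINT z|disk_measure \<alpha>. indicator {..<real m / real (Suc m)} (cmod z) *\<^sub>R G z)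
    \<longlonglongrightarrow> (LINT z|disk_measure \<alpha>. G z)"
proof (rule integral_dominated_convergence[where w = "\<lambda>z. norm (G z)"])
  have [measurable]: "G \<in> borel_measurable (disk_measure \<alpha>)"
    using assms by (rule borel_measurable_integrable)
  show "G \<in> borel_measurable (disk_measure \<alpha>)"
    by simp
  have [measurable]: "(\<lambda>z. indicator {..<r} (cmod z) :: real) \<in> borel_measurable (disk_measure \<alpha>)" for r
    by (rule borel_measurable_disk_measureI) simp
  show "(\<lambda>z. indicator {..<real m / real (Suc m)} (cmod z) *\<^sub>R G z) \<in> borel_measurable (disk_measure \<alpha>)" for m
    by simp
  show "integrable (disk_measure \<alpha>) (\<lambda>z. norm (G z))"
    using assms by simp
  show "AE z in disk_measure \<alpha>. (\<lambda>m. indicator {..<real m / real (Suc m)} (cmod z) *\<^sub>R G z) \<longlonglongrightarrow> G z"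
  proof (rule AE_I2)
    fix z assume "z \<in> space (disk_measure \<alpha>)"
    then have "cmod z < 1"
      by simp
    then have "\<forall>\<^sub>F m in sequentially. cmod z < real m / real (Suc m)"
      using order_tendstoD(1)[OF LIMSEQ_n_over_Suc_n[where 'a = real]] by blast
    then have "\<forall>\<^sub>F m in sequentially. indicator {..<real m / real (Suc m)} (cmod z) *\<^sub>R G z = G z"
      by eventually_elim simp
    then show "(\<lambda>m. indicator {..<real m / real (Suc m)} (cmod z) *\<^sub>R G z) \<longlonglongrightarrow> G z"
      by (rule tendsto_eventually)
  qed
  show "AE z in disk_measure \<alpha>. norm (indicator {..<real m / real (Suc m)} (cmod z) *\<^sub>R G z) \<le> norm (G z)" for m
    by (auto simp: indicator_def)
qed

text \<open>The condition \<open>j + l \<noteq> i + k\<close> says, without subtracting naturals,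
  that the angular frequencies \<open>j - k\<close> and \<open>i - l\<close> differ. Expanding both
  sums leaves monomials with unequal exponents, each killed by rotation.\<close>

lemma integral_disk_measure_orthogonal_monomials:
  fixes h :: "real \<Rightarrow> real"
  assumes "\<alpha> > -1" and [measurable]: "h \<in> borel_measurable borel" and h: "\<And>r. \<bar>h r\<bar> \<le> 1"
    and "finite A" "finite B"
    and freq: "\<And>k j l i. (k, j) \<in> A \<Longrightarrow> (l, i) \<in> B \<Longrightarrow> j + l \<noteq> i + k"
  shows "(LINT z|disk_measure \<alpha>. h (cmod z) *\<^sub>R ((\<Sum>(k, j)\<in>A. c k j * (z ^ j * cnj z ^ k))
      * cnj (\<Sum>(l, i)\<in>B. d l i * (z ^ i * cnj z ^ l)))) = 0"
proof -
  define F where "F x y z = (case x of (k, j) \<Rightarrow> case y of (l, i) \<Rightarrow>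
      c k j * cnj (d l i) * (of_real (h (cmod z)) * (z ^ (j + l) * cnj z ^ (i + k))))" for x y z
  have int: "integrable (disk_measure \<alpha>) (F x y)" for x y
  proof -
    obtain k j l i where xy: "x = (k, j)" "y = (l, i)"
      by (cases x; cases y)
    have "integrable (disk_measure \<alpha>) (\<lambda>z. of_real (h (cmod z)) * (z ^ (j + l) * cnj z ^ (i + k)))"
    proof (rule integrable_disk_measure_bounded[OF assms(1)])
      show "(\<lambda>z. of_real (h (cmod z)) * (z ^ (j + l) * cnj z ^ (i + k))) \<in> borel_measurable (disk_measure \<alpha>)"
        by (rule borel_measurable_disk_measureI) measurable
      show "norm (of_real (h (cmod z)) * (z ^ (j + l) * cnj z ^ (i + k))) \<le> 1" if "z \<in> unit_disk" for z
        using norm_monomial_le_1[OF that, of "j + l" "i + k"] h[of "cmod z"]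
        by (subst norm_mult) (intro mult_le_one, simp_all)
    qed
    then show ?thesis
      by (simp add: F_def[abs_def] xy)
  qed
  have "h (cmod z) *\<^sub>R ((\<Sum>(k, j)\<in>A. c k j * (z ^ j * cnj z ^ k)) * cnj (\<Sum>(l, i)\<in>B. d l i * (z ^ i * cnj z ^ l)))
      = (\<Sum>x\<in>A. \<Sum>y\<in>B. F x y z)" for z
    unfolding cnj_sum sum_product unfolding scaleR_conv_of_real sum_distrib_left F_def
    by (intro sum.cong refl) (auto simp: power_add mult_ac)
  then have "(LINT z|disk_measure \<alpha>. h (cmod z) *\<^sub>R ((\<Sum>(k, j)\<in>A. c k j * (z ^ j * cnj z ^ k))
      * cnj (\<Sum>(l, i)\<in>B. d l i * (z ^ i * cnj z ^ l))))
      = (\<Sum>x\<in>A. \<Sum>y\<in>B. LINT z|disk_measure \<alpha>. F x y z)"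
    using int by (simp add: Bochner_Integration.integral_sum Bochner_Integration.integrable_sum)
  also have "\<dots> = 0"
  proof (intro sum.neutral ballI)
    fix x y assume "x \<in> A" "y \<in> B"
    then show "(LINT z|disk_measure \<alpha>. F x y z) = 0"
      using integral_disk_measure_radial_monomial_eq_0[OF assms(1,2) freq]
      by (cases x; cases y) (simp add: F_def)
  qed
  finally show ?thesis .
qed

text \<open>Truncating by angular frequency \<open>j - k\<close> rather than by degree makes the partial sums
  orthogonal projections on every disk \<open>|z| < r\<close>. This holds first for \<open>r < 1\<close>, where the partial
  sums converge boundedly, and by exhaustion for \<open>r = 1\<close>.\<close>

lemma n_analytic_polynomial_approximation:
  assumes \<alpha>: "\<alpha> > -1" and f: "f \<in> n_analytic_Bergman_space n \<alpha>" and "\<epsilon> > 0"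
  shows "\<exists>N a. L2_norm (disk_measure \<alpha>)
    (\<lambda>z. f z - (\<Sum>(k, j)\<in>(SIGMA k:{..<n}. {..<N + k}). a k j * (z ^ j * cnj z ^ k))) < \<epsilon>"
proof -
  let ?M = "disk_measure \<alpha>"
  interpret finite_measure ?M
    by (rule finite_measure_disk_measure[OF \<alpha>])
  have sq: "square_integrable ?M f"
    using f by (simp add: n_analytic_Bergman_space_def)
  then have fm [measurable]: "f \<in> borel_measurable ?M" and f2: "integrable ?M (\<lambda>z. (cmod (f z))\<^sup>2)"
    by (simp_all add: square_integrable_def)
  have f1: "integrable ?M (\<lambda>z. cmod (f z))"
    by (rule square_integrable_imp_integrable[OF _ f2]) simp
  have "n_analytic_on n f unit_disk"
    using f by (simp add: n_analytic_Bergman_space_def)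
  then obtain g where g: "\<And>k. k < n \<Longrightarrow> g k holomorphic_on unit_disk"
      and fg: "\<And>z. z \<in> unit_disk \<Longrightarrow> f z = (\<Sum>k<n. cnj z ^ k * g k z)"
    unfolding n_analytic_on_def using n_analytic_decomposition[of unit_disk f n] by metis
  define a where "a k j = (deriv ^^ j) (g k) 0 / fact j" for k j
  have sums: "(\<lambda>j. a k j * z ^ j) sums g k z" if "k < n" "z \<in> unit_disk" for k z
    using holomorphic_power_series[OF g[OF that(1)] that(2)] by (simp add: a_def)
  \<comment> \<open>\<open>j < N + k\<close> means that the angular frequency \<open>j - k\<close>
    is below \<open>N\<close>; negative frequencies are always included.\<close>
  define A where "A N = (SIGMA k:{..<n}. {..<N + k})" for N
  define T where "T N z = (\<Sum>(k, j)\<in>A N. a k j * (z ^ j * cnj z ^ k))" for N z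
  have finA: "finite (A N)" for N
    by (simp add: A_def)
  have T_eq: "T N z = (\<Sum>k<n. cnj z ^ k * (\<Sum>j<N + k. a k j * z ^ j))" for N z
    unfolding T_def A_def by (subst sum.Sigma[symmetric]) (auto simp: sum_distrib_left mult_ac)
  have T_lim: "(\<lambda>N. T N z) \<longlonglongrightarrow> f z" if "z \<in> unit_disk" for z
    unfolding T_eq fg[OF that]
    by (intro tendsto_sum tendsto_mult_left LIMSEQ_ignore_initial_segment)
      (use sums[OF _ that] in \<open>auto simp: sums_def\<close>)
  have Tm [measurable]: "T N \<in> borel_measurable ?M" for N
    unfolding T_def[abs_def] by (intro borel_measurable_disk_measureI) (simp add: case_prod_beta)
  \<comment> \<open>A bound on \<open>|z| < r\<close> uniform in \<open>N\<close>: convergence at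
    the intermediate radius \<open>(r + 1) / 2\<close> forces absolute convergence at
    \<open>r\<close>.\<close>
  have T_bound: "\<exists>K\<ge>0. \<forall>N z. cmod z < r \<longrightarrow> cmod (T N z) \<le> K" if "r < 1" for r
  proof (cases "r \<le> 0")
    case False
    have summ: "summable (\<lambda>j. norm (a k j * complex_of_real r ^ j))" if "k < n" for k
    proof (rule powser_insidea[of "a k" "of_real ((r + 1) / 2)"])
      show "summable (\<lambda>j. a k j * complex_of_real ((r + 1) / 2) ^ j)"
      proof (rule sums_summable[OF sums[OF that]])
        have "norm (complex_of_real ((r + 1) / 2)) < 1"
          using \<open>r < 1\<close> False unfolding norm_of_real by simp
        then show "complex_of_real ((r + 1) / 2) \<in> unit_disk"
          by (simp del: of_real_divide)
      qed
      show "norm (complex_of_real r) < norm (complex_of_real ((r + 1) / 2))"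
        using \<open>r < 1\<close> False unfolding norm_of_real by simp
    qed
    define K where "K = (\<Sum>k<n. \<Sum>j. norm (a k j * complex_of_real r ^ j))"
    have "K \<ge> 0"
      unfolding K_def by (intro sum_nonneg suminf_nonneg summ) auto
    moreover have "cmod (T N z) \<le> K" if z: "cmod z < r" for N z
      unfolding T_eq K_def
    proof (rule sum_norm_le)
      fix k assume "k \<in> {..<n}"
      then have k: "k < n"
        by simp
      have "norm (\<Sum>j<N + k. a k j * z ^ j) \<le> (\<Sum>j<N + k. norm (a k j * complex_of_real r ^ j))"
        using z by (intro sum_norm_le) (auto simp: norm_mult norm_power intro!: mult_left_mono power_mono)
      also have "\<dots> \<le> (\<Sum>j. norm (a k j * complex_of_real r ^ j))"
        by (intro sum_le_suminf summ k) auto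
      finally have "norm (\<Sum>j<N + k. a k j * z ^ j) \<le> (\<Sum>j. norm (a k j * complex_of_real r ^ j))" .
      moreover have "norm (cnj z ^ k) \<le> 1"
        using z \<open>r < 1\<close> by (auto simp: norm_power intro!: power_le_one)
      ultimately show "norm (cnj z ^ k * (\<Sum>j<N + k. a k j * z ^ j)) \<le> (\<Sum>j. norm (a k j * complex_of_real r ^ j))"
        unfolding norm_mult by (intro order_trans[OF mult_left_le_one_le]) auto
    qed
    ultimately show ?thesis
      by blast
  next
    case True
    then have "\<not> cmod z < r" for z
      using norm_ge_zero[of z] by linarith
    then show ?thesis
      by blast
  qed
  have T_bound1: "\<exists>B\<ge>0. \<forall>z\<in>unit_disk. cmod (T N z) \<le> B" for N
  proof (intro exI conjI ballI)
    show "0 \<le> (\<Sum>(k, j)\<in>A N. cmod (a k j))"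
      by (intro sum_nonneg) auto
    show "cmod (T N z) \<le> (\<Sum>(k, j)\<in>A N. cmod (a k j))" if "z \<in> unit_disk" for z
      unfolding T_def using norm_monomial_le_1[OF that]
      by (intro sum_norm_le) (auto simp: norm_mult intro!: mult_left_le)
  qed
  define h :: "real \<Rightarrow> real \<Rightarrow> real" where "h r = indicator {..<r}" for r
  have h: "h r \<in> borel_measurable borel" "\<bar>h r t\<bar> \<le> 1" for r t
    by (auto simp: h_def indicator_def)
  have hm [measurable]: "(\<lambda>z. h r (cmod z)) \<in> borel_measurable ?M" for r
    by (intro borel_measurable_disk_measureI) (simp add: h_def)

  \<comment> \<open>Terms added after \<open>N\<close> have frequency at least \<open>N\<close>,
    those of \<open>T N\<close> a smaller one.\<close>
  have orth_trunc: "(LINT z|?M. h r (cmod z) *\<^sub>R (T N z * cnj (T (N + m) z - T N z))) = 0" for r N m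
  proof -
    have "A N \<subseteq> A (N + m)"
      by (auto simp: A_def)
    then have "T (N + m) z - T N z = (\<Sum>(k, j)\<in>A (N + m) - A N. a k j * (z ^ j * cnj z ^ k))" for z
      unfolding T_def by (simp add: sum_diff finA)
    then show ?thesis
      unfolding T_def[of N]
      by (simp only:) (rule integral_disk_measure_orthogonal_monomials[OF \<alpha> h]; auto simp: A_def)
  qed
  have orth_r: "(LINT z|?M. h r (cmod z) *\<^sub>R (T N z * cnj (f z - T N z))) = 0" if r: "r < 1" for r N
  proof -
    \<comment> \<open>This bound dominates while \<open>m\<close> tends to infinity with
      \<open>N\<close> fixed, so that \<open>T (N + m)\<close> turns into \<open>f\<close>.\<close>
    obtain K where K: "K \<ge> 0" "\<And>N z. cmod z < r \<Longrightarrow> cmod (T N z) \<le> K"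
      using T_bound[OF r] by blast
    have "(\<lambda>m. LINT z|?M. h r (cmod z) *\<^sub>R (T N z * cnj (T (N + m) z - T N z)))
        \<longlonglongrightarrow> (LINT z|?M. h r (cmod z) *\<^sub>R (T N z * cnj (f z - T N z)))"
    proof (rule integral_dominated_convergence[where w = "\<lambda>_. K * (K + K)"])
      show "AE z in ?M. (\<lambda>m. h r (cmod z) *\<^sub>R (T N z * cnj (T (N + m) z - T N z)))
          \<longlonglongrightarrow> h r (cmod z) *\<^sub>R (T N z * cnj (f z - T N z))"
        using LIMSEQ_ignore_initial_segment[OF T_lim, of _ N]
        by (intro AE_I2 tendsto_intros) (simp add: add.commute)
      show "AE z in ?M. norm (h r (cmod z) *\<^sub>R (T N z * cnj (T (N + m) z - T N z))) \<le> K * (K + K)" for m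
      proof (rule AE_I2)
        fix z
        show "norm (h r (cmod z) *\<^sub>R (T N z * cnj (T (N + m) z - T N z))) \<le> K * (K + K)"
        proof (cases "cmod z < r")
          case True
          have "norm (T (N + m) z - T N z) \<le> K + K"
            using K(2)[OF True] norm_triangle_ineq4 add_mono order_trans by metis
          then show ?thesis
            using True K(1) K(2)[OF True, of N] by (simp add: h_def norm_mult mult_mono flip: complex_cnj_diff)
        qed (use K(1) in \<open>simp add: h_def\<close>)
      qed
    qed auto
    then show ?thesis
      unfolding orth_trunc by (rule LIMSEQ_unique[OF tendsto_const, symmetric])
  qed
  have int_TT: "integrable ?M (\<lambda>z. (cmod (T N z))\<^sup>2)" for N
  proof -
    obtain B where B: "B \<ge> 0" "\<And>z. z \<in> unit_disk \<Longrightarrow> cmod (T N z) \<le> B"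
      using T_bound1 by blast
    show ?thesis
      by (rule integrable_disk_measure_bounded[OF \<alpha>, where B = "B\<^sup>2"]) (use B in \<open>auto simp: power_mono\<close>)
  qed
  have int_Tf: "integrable ?M (\<lambda>z. T N z * cnj (f z - T N z))" for N
  proof -
    obtain B where B: "B \<ge> 0" "\<And>z. z \<in> unit_disk \<Longrightarrow> cmod (T N z) \<le> B"
      using T_bound1 by blast
    show ?thesis
    proof (rule Bochner_Integration.integrable_bound)
      show "integrable ?M (\<lambda>z. B * (cmod (f z) + B))"
        using f1 by simp
      show "AE z in ?M. norm (T N z * cnj (f z - T N z)) \<le> norm (B * (cmod (f z) + B))"
      proof (rule AE_I2)
        fix z assume "z \<in> space ?M"
        then have "cmod (T N z) \<le> B"
          using B(2) by simp
        moreover from this have "cmod (f z - T N z) \<le> cmod (f z) + B"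
          using norm_triangle_ineq4[of "f z" "T N z"] by linarith
        ultimately have "cmod (T N z) * cmod (f z - T N z) \<le> B * (cmod (f z) + B)"
          using B(1) by (intro mult_mono) auto
        then show "norm (T N z * cnj (f z - T N z)) \<le> norm (B * (cmod (f z) + B))"
          using B(1) by (simp add: norm_mult flip: complex_cnj_diff)
      qed
    qed simp
  qed
  have orth: "(LINT z|?M. T N z * cnj (f z - T N z)) = 0" for N
  proof -
    have "(\<lambda>m. LINT z|?M. indicator {..<real m / real (Suc m)} (cmod z) *\<^sub>R (T N z * cnj (f z - T N z)))
        \<longlonglongrightarrow> (LINT z|?M. T N z * cnj (f z - T N z))"
      by (rule integral_disk_measure_exhaust[OF int_Tf])
    moreover have "(LINT z|?M. indicator {..<real m / real (Suc m)} (cmod z) *\<^sub>R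
        (T N z * cnj (f z - T N z))) = 0" for m
      by (rule orth_r[unfolded h_def]) simp
    ultimately show ?thesis
      by (simp only: LIMSEQ_const_iff)
  qed
  have expand: "(cmod (f z - T N z))\<^sup>2 = (cmod (f z))\<^sup>2 - (cmod (T N z))\<^sup>2 - 2 * Re (T N z * cnj (f z - T N z))" for N z
    by (simp add: cmod_power2) (simp add: power2_eq_square algebra_simps)
  have pyth: "(LINT z|?M. (cmod (f z - T N z))\<^sup>2) = (LINT z|?M. (cmod (f z))\<^sup>2) - (LINT z|?M. (cmod (T N z))\<^sup>2)" for N
  proof -
    have "(LINT z|?M. Re (T N z * cnj (f z - T N z))) = 0"
      using integral_Re[OF int_Tf] orth by simp
    moreover have "integrable ?M (\<lambda>z. Re (T N z * cnj (f z - T N z)))"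
      by (rule integrable_Re[OF int_Tf])
    ultimately show ?thesis
      unfolding expand using f2 int_TT by (simp del: times_complex.sel complex_cnj_diff)
  qed

  define \<delta> where "\<delta> = \<epsilon>\<^sup>2 / 2"
  have "\<delta> > 0"
    using \<open>\<epsilon> > 0\<close> by (simp add: \<delta>_def)
  define L where "L = (LINT z|?M. (cmod (f z))\<^sup>2)"
  have "\<forall>\<^sub>F m in sequentially.
      (LINT z|?M. h (real m / real (Suc m)) (cmod z) *\<^sub>R (cmod (f z))\<^sup>2) > L - \<delta>"
    unfolding h_def
    by (rule order_tendstoD(1)[OF integral_disk_measure_exhaust[OF f2]]) (simp add: L_def \<open>\<delta> > 0\<close>)
  \<comment> \<open>The disk of this radius misses less than \<open>\<delta>\<close> of the squared
    norm of \<open>f\<close>.\<close>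
  then obtain m where m: "(LINT z|?M. h (real m / real (Suc m)) (cmod z) *\<^sub>R (cmod (f z))\<^sup>2) > L - \<delta>"
    using eventually_happens'[OF sequentially_bot] by blast
  define r where "r = real m / real (Suc m)"
  have "r < 1"
    by (simp add: r_def)
  then obtain K where K: "K \<ge> 0" "\<And>N z. cmod z < r \<Longrightarrow> cmod (T N z) \<le> K"
    using T_bound by blast
  have "(\<lambda>N. LINT z|?M. h r (cmod z) *\<^sub>R (cmod (T N z))\<^sup>2) \<longlonglongrightarrow> (LINT z|?M. h r (cmod z) *\<^sub>R (cmod (f z))\<^sup>2)"
  proof (rule integral_dominated_convergence[where w = "\<lambda>_. K\<^sup>2"])
    show "AE z in ?M. (\<lambda>N. h r (cmod z) *\<^sub>R (cmod (T N z))\<^sup>2) \<longlonglongrightarrow> h r (cmod z) *\<^sub>R (cmod (f z))\<^sup>2"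
      using T_lim by (intro AE_I2 tendsto_intros) auto
    show "AE z in ?M. norm (h r (cmod z) *\<^sub>R (cmod (T N z))\<^sup>2) \<le> K\<^sup>2" for N
      using K by (auto simp: h_def indicator_def intro!: power_mono)
  qed auto
  moreover have "L - \<epsilon>\<^sup>2 < (LINT z|?M. h r (cmod z) *\<^sub>R (cmod (f z))\<^sup>2)"
    using m \<open>\<delta> > 0\<close> unfolding r_def[symmetric] \<delta>_def by linarith
  ultimately have "\<forall>\<^sub>F N in sequentially. (LINT z|?M. h r (cmod z) *\<^sub>R (cmod (T N z))\<^sup>2) > L - \<epsilon>\<^sup>2"
    by (rule order_tendstoD(1))
  then obtain N where N: "(LINT z|?M. h r (cmod z) *\<^sub>R (cmod (T N z))\<^sup>2) > L - \<epsilon>\<^sup>2"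
    using eventually_happens'[OF sequentially_bot] by blast
  have "(LINT z|?M. h r (cmod z) *\<^sub>R (cmod (T N z))\<^sup>2) \<le> (LINT z|?M. (cmod (T N z))\<^sup>2)"
    by (rule integral_mono'[OF int_TT]) (auto simp: h_def indicator_def)
  then have "(LINT z|?M. (cmod (f z - T N z))\<^sup>2) < \<epsilon>\<^sup>2"
    unfolding pyth using N L_def by linarith
  then have "L2_norm ?M (\<lambda>z. f z - T N z) < \<epsilon>"
    unfolding L2_norm_def using \<open>\<epsilon> > 0\<close> by (simp add: real_less_lsqrt)
  then show ?thesis
    unfolding T_def A_def by blast
qed

section \<open>Finite linear combinations on the disk\<close>

definition in_disk_span :: "'i set \<Rightarrow> ('i \<Rightarrow> complex \<Rightarrow> complex) \<Rightarrow> (complex \<Rightarrow> complex) \<Rightarrow> bool" where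
  "in_disk_span I e u \<longleftrightarrow>
     (\<exists>F c. finite F \<and> F \<subseteq> I \<and> (\<forall>z\<in>unit_disk. u z = (\<Sum>i\<in>F. c i * e i z)))"

lemma in_disk_span_cong:
  "in_disk_span I e u \<Longrightarrow> (\<And>z. z \<in> unit_disk \<Longrightarrow> u z = v z) \<Longrightarrow> in_disk_span I e v"
  by (fastforce simp: in_disk_span_def)

lemma in_disk_span_base: "i \<in> I \<Longrightarrow> in_disk_span I e (e i)"
  unfolding in_disk_span_def by (intro exI[of _ "{i}"] exI[of _ "\<lambda>_. 1"]) auto

lemma in_disk_span_cmult:
  assumes "in_disk_span I e u"
  shows "in_disk_span I e (\<lambda>z. a * u z)"
proof -
  obtain F c where "finite F" "F \<subseteq> I" "\<forall>z\<in>unit_disk. u z = (\<Sum>i\<in>F. c i * e i z)"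
    using assms by (auto simp: in_disk_span_def)
  then show ?thesis
    unfolding in_disk_span_def
    by (intro exI[of _ F] exI[of _ "\<lambda>i. a * c i"]) (auto simp: sum_distrib_left mult.assoc)
qed

lemma in_disk_span_add:
  assumes "in_disk_span I e u" "in_disk_span I e v"
  shows "in_disk_span I e (\<lambda>z. u z + v z)"
proof -
  obtain F c where F: "finite F" "F \<subseteq> I" "\<And>z. z \<in> unit_disk \<Longrightarrow> u z = (\<Sum>i\<in>F. c i * e i z)"
    using assms(1) by (auto simp: in_disk_span_def)
  obtain G d where G: "finite G" "G \<subseteq> I" "\<And>z. z \<in> unit_disk \<Longrightarrow> v z = (\<Sum>i\<in>G. d i * e i z)"
    using assms(2) by (auto simp: in_disk_span_def)
  define b where "b i = (if i \<in> F then c i else 0) + (if i \<in> G then d i else 0)" for i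
  have "u z + v z = (\<Sum>i\<in>F \<union> G. b i * e i z)" if "z \<in> unit_disk" for z
  proof -
    have "(\<Sum>i\<in>F \<union> G. b i * e i z) = (\<Sum>i\<in>F \<union> G. if i \<in> F then c i * e i z else 0)
        + (\<Sum>i\<in>F \<union> G. if i \<in> G then d i * e i z else 0)"
      unfolding b_def sum.distrib[symmetric] by (intro sum.cong refl) (auto simp: distrib_right)
    also have "\<dots> = (\<Sum>i\<in>F. c i * e i z) + (\<Sum>i\<in>G. d i * e i z)"
      using F(1) G(1) by (intro arg_cong2[of _ _ _ _ "(+)"] sum.mono_neutral_cong_right) auto
    finally show ?thesis
      using F(3) G(3) that by simp
  qed
  then show ?thesis
    unfolding in_disk_span_def using F G by (intro exI[of _ "F \<union> G"] exI[of _ b]) auto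
qed

lemma in_disk_span_sum:
  assumes "finite J" "\<And>j. j \<in> J \<Longrightarrow> in_disk_span I e (u j)"
  shows "in_disk_span I e (\<lambda>z. \<Sum>j\<in>J. u j z)"
  using assms
proof (induction J)
  case empty
  show ?case
    unfolding in_disk_span_def by (intro exI[of _ "{}"]) auto
next
  case (insert j J)
  then show ?case
    by (simp add: in_disk_span_add)
qed

text \<open>The expansion of \<open>disk_poly \<alpha> a b\<close> is triangular: a nonzero multiple
  of the monomial plus terms of lower degree in \<open>cnj z\<close>, covered by the induction
  hypothesis. Degrees only drop, so the bound \<open>n\<close> is respected.\<close>

lemma monomial_in_disk_span:
  assumes "\<alpha> > -1" "b < n"
  shows "in_disk_span {(p, q) | p q. q < n} (\<lambda>(p, q). disk_poly \<alpha> p q) (\<lambda>z. z ^ a * cnj z ^ b)"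
  using assms(2)
proof (induction b arbitrary: a rule: less_induct)
  case (less b)
  let ?S = "in_disk_span {(p, q) | p q. q < n} (\<lambda>(p, q). disk_poly \<alpha> p q)"
  define d where "d j = complex_of_real (disk_poly_monom \<alpha> a b j)" for j
  have "d b \<noteq> 0"
    using disk_poly_coeff_normalizes[OF assms(1), of a b] by (auto simp: d_def)
  have "?S (disk_poly \<alpha> a b)"
    using in_disk_span_base[of "(a, b)" "{(p, q) | p q. q < n}" "\<lambda>(p, q). disk_poly \<alpha> p q"] less.prems
    by simp
  moreover have "?S (\<lambda>z. \<Sum>j<b. - d j * (z ^ (a - (b - j)) * cnj z ^ j))"
    using less by (intro in_disk_span_sum in_disk_span_cmult) auto
  ultimately have "?S (\<lambda>z. 1 / d b * (disk_poly \<alpha> a b z + (\<Sum>j<b. - d j * (z ^ (a - (b - j)) * cnj z ^ j))))"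
    by (intro in_disk_span_cmult in_disk_span_add)
  then show ?case
  proof (rule in_disk_span_cong)
    fix z :: complex assume "z \<in> unit_disk"
    then have "disk_poly \<alpha> a b z = (\<Sum>j<b. d j * (z ^ (a - (b - j)) * cnj z ^ j)) + d b * (z ^ a * cnj z ^ b)"
      by (simp add: disk_poly_eq_monomials d_def flip: lessThan_Suc_atMost)
    then show "1 / d b * (disk_poly \<alpha> a b z + (\<Sum>j<b. - d j * (z ^ (a - (b - j)) * cnj z ^ j))) = z ^ a * cnj z ^ b"
      using \<open>d b \<noteq> 0\<close> by (simp add: sum_negf)
  qed
qed

theorem proposition5p1:
  fixes n :: nat and \<alpha> :: real
  assumes "n \<ge> 1" and "\<alpha> > -1"
  shows "is_orthonormal_basis (disk_measure \<alpha>) (n_analytic_Bergman_space n \<alpha>)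
           {(p, q) | p q. q < n} (\<lambda>(p, q). disk_poly \<alpha> p q)"
  unfolding is_orthonormal_basis_def
proof (intro conjI ballI allI impI)
  let ?I = "{(p, q) | p q. q < n}" and ?e = "\<lambda>(p, q). disk_poly \<alpha> p q"
  show "?e i \<in> n_analytic_Bergman_space n \<alpha>" if "i \<in> ?I" for i
    using that disk_poly_in_space[OF assms(2)] by auto
  show "L2_inner (disk_measure \<alpha>) (?e i) (?e j) = (if i = j then 1 else 0)" for i j
    by (cases i; cases j) (simp add: disk_poly_orthonormal[OF assms(2)])
  fix f and \<epsilon> :: real assume "f \<in> n_analytic_Bergman_space n \<alpha>" "\<epsilon> > 0"
  then obtain N a where a: "L2_norm (disk_measure \<alpha>)
      (\<lambda>z. f z - (\<Sum>(k, j)\<in>(SIGMA k:{..<n}. {..<N + k}). a k j * (z ^ j * cnj z ^ k))) < \<epsilon>"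
    using n_analytic_polynomial_approximation[OF assms(2)] by blast
  define P where "P z = (\<Sum>(k, j)\<in>(SIGMA k:{..<n}. {..<N + k}). a k j * (z ^ j * cnj z ^ k))" for z
  have "in_disk_span ?I ?e P"
    unfolding P_def
  proof (rule in_disk_span_sum)
    fix x assume "x \<in> (SIGMA k:{..<n}. {..<N + k})"
    then obtain k j where "x = (k, j)" "k < n"
      by blast
    then show "in_disk_span ?I ?e (\<lambda>z. case x of (k, j) \<Rightarrow> a k j * (z ^ j * cnj z ^ k))"
      using in_disk_span_cmult[OF monomial_in_disk_span[OF assms(2), of k n j]] by simp
  qed simp
  then obtain F c where F: "finite F" "F \<subseteq> ?I" and c: "\<forall>z\<in>unit_disk. P z = (\<Sum>i\<in>F. c i * ?e i z)"
    unfolding in_disk_span_def by (elim exE conjE) (rule that)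
  \<comment> \<open>The measure lives on the disk, so the identity for \<open>P\<close> there is
    enough.\<close>
  have "L2_norm (disk_measure \<alpha>) (\<lambda>z. f z - (\<Sum>i\<in>F. c i * ?e i z))
      = L2_norm (disk_measure \<alpha>) (\<lambda>z. f z - P z)"
    unfolding L2_norm_def
    by (intro arg_cong[of _ _ sqrt] Bochner_Integration.integral_cong refl)
      (simp only: bspec[OF c] space_disk_measure)
  also have "\<dots> < \<epsilon>"
    using a by (simp only: P_def)
  finally show "\<exists>F c. finite F \<and> F \<subseteq> ?I \<and> L2_norm (disk_measure \<alpha>) (\<lambda>x. f x - (\<Sum>i\<in>F. c i * ?e i x)) < \<epsilon>"
    using F by (intro exI[of _ F] exI[of _ c] conjI)
qed

end
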